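(* (a) All minimal vanishing sums of roots of unity having weight less than $21$ are of height $1$. (b) There are minimal vanishing sums of roots of unity of weight $21$ and height strictly greater than $1$; they all have height $2$.
   Context: A sum of roots of unity is an unordered finite nonempty list $h=(\omega_1,\dots,\omega_n)$ of roots of unity in $\mathbb{C}$, repetitions allowed. Its weight is $n$, its value is the complex number $\sum_{j=1}^n\omega_j$, and its height is the maximum multiplicity with which a root of unity occurs in the list. It vanishes if its value is $0$. It is minimal vanishing if it vanishes and no proper nonempty sublist of it vanishes. *)

theory Defs
  imports Complex_Main "HOL-Library.Multiset"
begin

definition root_of_unity :: "complex \<Rightarrow> bool" where
  "root_of_unity z \<longleftrightarrow> (\<exists>n::nat. n > 0 \<and> z ^ n = 1)"

(* Unordered finite lists with repetitions are represented by multisets: the weight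
   of h is size h and the value of h is sum_mset h. *)

definition sum_of_roots_of_unity :: "complex multiset \<Rightarrow> bool" where
  "sum_of_roots_of_unity h \<longleftrightarrow> h \<noteq> {#} \<and> (\<forall>z \<in># h. root_of_unity z)"

abbreviation weight :: "complex multiset \<Rightarrow> nat" where
  "weight h \<equiv> size h"

definition height :: "complex multiset \<Rightarrow> nat" where
  "height h = Max (count h ` set_mset h)"

definition vanishing :: "complex multiset \<Rightarrow> bool" where
  "vanishing h \<longleftrightarrow> sum_mset h = 0"

definition minimal_vanishing :: "complex multiset \<Rightarrow> bool" where
  "minimal_vanishing h \<longleftrightarrow>
     vanishing h \<and> (\<forall>g. g \<subset># h \<and> g \<noteq> {#} \<longrightarrow> \<not> vanishing g)"

end

theory Submission
  imports Defs "Jordan_Normal_Form.Char_Poly" "HOL-Number_Theory.Cong"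
begin

text \<open>
Write \<mu>_n for the group of n-th roots of unity. The proof takes a minimal vanishing sum h
apart along one prime at a time. Rotate h so that it lies in \<mu>_N with N as small as
possible. If p is a prime and N = pM, then h is the union of the multisets c F_c, where c
runs through \<mu>_p and the part F_c lies in \<mu>_M. Vanishing sums in \<mu>_N stay vanishing
when all roots are raised to a power coprime to N (\<open>vanishing_power\<close>, the irreducibility of the
cyclotomic polynomials in disguise). Averaging over such powers shows that p does not divide M
(\<open>reduced_prime_not_dvd\<close>) and that all parts have the same value v
(\<open>part_value_const\<close>), which is not 0 (\<open>reduced_part_value_nonzero\<close>). Conversely,
subsums of all the parts with one common value make up a vanishing subsum of h, so by minimality
0 and v are the only values that are attained by subsums of every part
(\<open>equal_subvalues\<close>).

Now let h have weight at most 21 and contain a root twice; that root shows up as a repeated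
element m of some part F. Argue by induction on the weight.

\<^item> If p \<ge> 3 and some part is a single root x, then F together with -x is a shorter
  minimal vanishing sum with a repeated root. So for p \<ge> 3 every part has at least two elements, 2p \<le> 21,
  and N, being square-free, divides 210 (\<open>dvd_210\<close>).

\<^item> In \<mu>_30 the roots of a minimal vanishing sum are distinct, and the order of the quotient
  of two of them bounds the weight from below (\<open>minimal_ratio_in_weight\<close>). So 7 divides
  N; take p = 7, so that the parts lie in \<mu>_30.

\<^item> If some part is {x, y}, then F splits into X with value x and Y with value y, for
  otherwise F together with -x, -y would be a shorter minimal vanishing sum with a repeated
  root. By induction m occurs exactly once in X and exactly once in Y, hence twice in F. Not
  every part splits in this way, since x is not a common subvalue; a part F' that does not gives a
  minimal vanishing sum F' \<union> {-x, -y}. The quotients m/(-x), (-x)/(-y) and m/(-y) then occur in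
  three minimal vanishing sums in \<mu>_30, and the third quotient is the product of the others,
  which forces the weights of these sums to add up to at least 15 (\<open>ratio_triangle\<close>), unless all three
  quotients have order 3; but then m = x + y, and F without m vanishes. Thus F and F'
  have at least 11 elements together, the other five parts at least 10, and h has weight 21.

\<^item> If every part has at least three elements, the weight is 21 and all parts have exactly three.
  A root of multiplicity 3 would make one part equal to {m, m, m} with value 3m; then all
  parts contain m, which is impossible.

The case of equality suggests the sum of weight 21 with a repeated root: let \<omega> be a primitive
cube root and \<zeta> a primitive fifth root of unity. With {x, y} = {-\<omega>, -\<zeta>}, take
F = {1, \<omega>^2} \<union> {1, \<zeta>^2, \<zeta>^3, \<zeta>^4} and
F' = {1, \<omega>\<zeta>, -\<omega>^2\<zeta>^2, -\<omega>^2\<zeta>^3, -\<omega>^2\<zeta>^4}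
(\<open>repeated_root_of_weight_21\<close>).
\<close>

section \<open>Powers of the roots in a vanishing sum\<close>

text \<open>
The characteristic polynomial of an integer matrix is monic with integer coefficients.
\<close>

lemma algebraic_int_eigenvalue_int_matrix:
  fixes A :: "nat \<Rightarrow> nat \<Rightarrow> int" and v :: "nat \<Rightarrow> complex"
  assumes eq: "\<And>i. i < n \<Longrightarrow> (\<Sum>k<n. of_int (A i k) * v k) = \<alpha> * v i"
    and nz: "i\<^sub>0 < n" "v i\<^sub>0 \<noteq> 0"
  shows "algebraic_int \<alpha>"
proof -
  define B where "B = mat n n (\<lambda>(i, k). A i k)"
  define C :: "complex mat" where "C = map_mat of_int B"
  have B: "B \<in> carrier_mat n n" by (simp add: B_def)
  have C: "C \<in> carrier_mat n n" by (simp add: C_def B_def)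
  have "C *\<^sub>v vec n v = \<alpha> \<cdot>\<^sub>v vec n v"
    by (rule eq_vecI) (simp_all add: C_def B_def scalar_prod_def lessThan_atLeast0 [symmetric] eq)
  moreover have "vec n v \<noteq> 0\<^sub>v n"
  proof
    assume "vec n v = 0\<^sub>v n"
    then have "vec n v $ i\<^sub>0 = 0\<^sub>v n $ i\<^sub>0" by simp
    with nz show False by simp
  qed
  ultimately have "eigenvalue C \<alpha>"
    using C unfolding eigenvalue_def eigenvector_def by (intro exI [of _ "vec n v"]) auto
  then have "poly (char_poly C) \<alpha> = 0"
    using eigenvalue_root_char_poly [OF C] by simp
  moreover have "char_poly C = map_poly of_int (char_poly B)"
    unfolding C_def by (rule of_int_hom.char_poly_hom [OF B])
  ultimately show ?thesis
    using degree_monic_char_poly [OF B] by (auto simp: algebraic_int_altdef_ipoly)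
qed

definition int_adjoin :: "complex \<Rightarrow> complex set" where
  "int_adjoin \<zeta> = range (\<lambda>P :: int poly. poly (map_poly of_int P) \<zeta>)"

lemma int_adjoin_add: "a \<in> int_adjoin \<zeta> \<Longrightarrow> b \<in> int_adjoin \<zeta> \<Longrightarrow> a + b \<in> int_adjoin \<zeta>"
  unfolding int_adjoin_def by (auto simp: image_iff) (metis of_int_hom.map_poly_hom_add poly_add)

lemma int_adjoin_diff: "a \<in> int_adjoin \<zeta> \<Longrightarrow> b \<in> int_adjoin \<zeta> \<Longrightarrow> a - b \<in> int_adjoin \<zeta>"
  unfolding int_adjoin_def by (auto simp: image_iff) (metis of_int_poly_hom.hom_minus poly_diff)

lemma int_adjoin_mult: "a \<in> int_adjoin \<zeta> \<Longrightarrow> b \<in> int_adjoin \<zeta> \<Longrightarrow> a * b \<in> int_adjoin \<zeta>"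
  unfolding int_adjoin_def by (auto simp: image_iff) (metis of_int_poly_hom.hom_mult poly_mult)

lemma int_adjoin_of_int: "of_int k \<in> int_adjoin \<zeta>"
  unfolding int_adjoin_def image_iff by (rule bexI [of _ "[:k:]"]) (simp_all add: of_int_hom.map_poly_pCons_hom)

lemma int_adjoin_gen: "\<zeta> \<in> int_adjoin \<zeta>"
  unfolding int_adjoin_def image_iff by (rule bexI [of _ "[:0, 1:]"]) (simp_all add: of_int_hom.map_poly_pCons_hom)

lemma int_adjoin_0: "0 \<in> int_adjoin \<zeta>" and int_adjoin_1: "1 \<in> int_adjoin \<zeta>"
  and int_adjoin_of_nat: "of_nat m \<in> int_adjoin \<zeta>"
  using int_adjoin_of_int [of 0] int_adjoin_of_int [of 1] int_adjoin_of_int [of "int m"] by auto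

lemma int_adjoin_power: "a \<in> int_adjoin \<zeta> \<Longrightarrow> a ^ n \<in> int_adjoin \<zeta>"
  by (induction n) (auto intro: int_adjoin_1 int_adjoin_mult)

lemma int_adjoin_sum: "(\<And>i. i \<in> I \<Longrightarrow> f i \<in> int_adjoin \<zeta>) \<Longrightarrow> sum f I \<in> int_adjoin \<zeta>"
  by (induction I rule: infinite_finite_induct) (auto intro: int_adjoin_0 int_adjoin_add)

lemma int_adjoin_sum_mset: "(\<And>z. z \<in># h \<Longrightarrow> z \<in> int_adjoin \<zeta>) \<Longrightarrow> sum_mset h \<in> int_adjoin \<zeta>"
  by (induction h) (auto intro: int_adjoin_0 int_adjoin_add)

lemma root_of_unity_power_mod:
  fixes z :: "'a :: monoid_mult"
  assumes "z ^ N = 1"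
  shows "z ^ (m mod N) = z ^ m"
proof -
  have "z ^ m = (z ^ N) ^ (m div N) * z ^ (m mod N)"
    by (metis mult_div_mod_eq power_add power_mult)
  then show ?thesis using assms by simp
qed

text \<open>
Multiplication by \<alpha> maps each of the powers 1, \<zeta>, ..., \<zeta>^(N-1) to an integer combination of
these powers, so \<alpha> is an eigenvalue of an integer matrix.
\<close>

lemma int_adjoin_algebraic_int:
  assumes "\<zeta> ^ N = 1" "N > 0" and \<alpha>: "\<alpha> \<in> int_adjoin \<zeta>"
  shows "algebraic_int \<alpha>"
proof -
  note red = root_of_unity_power_mod [OF assms(1)]
  obtain P :: "int poly" where P: "\<alpha> = poly (map_poly of_int P) \<zeta>"
    using \<alpha> by (auto simp: int_adjoin_def)
  define D where "D = {..degree P}"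
  have \<alpha>_eq: "\<alpha> = (\<Sum>j\<in>D. of_int (coeff P j) * \<zeta> ^ j)"
    by (simp add: P poly_altdef D_def)
  show ?thesis
  proof (rule algebraic_int_eigenvalue_int_matrix)
    show "(\<Sum>k<N. of_int (\<Sum>j | j \<in> D \<and> (j + i) mod N = k. coeff P j) * \<zeta> ^ k) = \<alpha> * \<zeta> ^ i"
      for i
    proof -
      have "(\<Sum>k<N. of_int (\<Sum>j | j \<in> D \<and> (j + i) mod N = k. coeff P j) * \<zeta> ^ k)
          = (\<Sum>k<N. \<Sum>j | j \<in> D \<and> (j + i) mod N = k. of_int (coeff P j) * \<zeta> ^ (j + i))"
        by (intro sum.cong refl) (auto simp: sum_distrib_right red intro!: sum.cong)
      also have "\<dots> = (\<Sum>j\<in>D. of_int (coeff P j) * \<zeta> ^ (j + i))"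
        using assms(2) by (intro sum.group) (auto simp: D_def)
      also have "\<dots> = \<alpha> * \<zeta> ^ i"
        unfolding \<alpha>_eq sum_distrib_right power_add by (simp add: mult.assoc)
      finally show ?thesis .
    qed
  qed (use assms in auto)
qed

text \<open>
A nonzero constant term of a monic integer polynomial with root \<alpha> is, up to sign, a multiple of
\<alpha> in the ring. If the constant term is zero, the polynomial can be divided by the indeterminate.
\<close>

lemma int_adjoin_divides_int:
  assumes "\<zeta> ^ N = 1" "N > 0" and \<alpha>: "\<alpha> \<in> int_adjoin \<zeta>" "\<alpha> \<noteq> 0"
  shows "\<exists>c::int. \<exists>\<gamma>\<in>int_adjoin \<zeta>. c \<noteq> 0 \<and> \<alpha> * \<gamma> = of_int c"
proof -
  obtain P :: "int poly" where P: "poly (map_poly of_int P) \<alpha> = 0" "lead_coeff P = 1"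
    using int_adjoin_algebraic_int [OF assms(1-3)] by (auto simp: algebraic_int_altdef_ipoly)
  have "P \<noteq> 0" using P(2) by auto
  then show ?thesis using P(1)
  proof (induction "degree P" arbitrary: P rule: less_induct)
    case less
    obtain a Q where PQ: "P = pCons a Q" by (cases P) auto
    have eq: "of_int a + \<alpha> * poly (map_poly of_int Q) \<alpha> = 0"
      using less.prems(2) by (simp add: PQ of_int_hom.map_poly_pCons_hom)
    show ?case
    proof (cases "a = 0")
      case True
      with less.prems PQ have "Q \<noteq> 0" by auto
      moreover have "poly (map_poly of_int Q) \<alpha> = 0" using eq True \<alpha>(2) by simp
      ultimately show ?thesis using less.hyps [of Q] PQ by simp
    next
      case False
      have "poly (map_poly of_int Q) \<alpha> \<in> int_adjoin \<zeta>"
        by (auto simp: poly_altdef intro!: int_adjoin_sum int_adjoin_mult int_adjoin_of_int int_adjoin_power \<alpha>)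
      then show ?thesis
        using False eq by (intro exI [of _ "-a"] bexI [of _ "poly (map_poly of_int Q) \<alpha>"])
          (auto simp: add_eq_0_iff)
    qed
  qed
qed

lemma frobenius_add:
  fixes a b \<zeta> :: complex
  assumes q: "prime q" and ab: "a \<in> int_adjoin \<zeta>" "b \<in> int_adjoin \<zeta>"
  shows "\<exists>c\<in>int_adjoin \<zeta>. (a + b) ^ q = a ^ q + b ^ q + of_nat q * c"
proof
  let ?c = "\<Sum>k\<in>{0<..<q}. of_nat ((q choose k) div q) * a ^ k * b ^ (q - k)"
  show "?c \<in> int_adjoin \<zeta>"
    by (intro int_adjoin_sum int_adjoin_mult int_adjoin_power int_adjoin_of_nat ab)
  have "q > 0" using q by (simp add: prime_gt_0_nat)
  then have split: "{..q} = insert 0 (insert q {0<..<q})" by auto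
  have "of_nat q * ?c = (\<Sum>k\<in>{0<..<q}. of_nat (q choose k) * a ^ k * b ^ (q - k))"
  proof (unfold sum_distrib_left, rule sum.cong, rule refl)
    fix k assume "k \<in> {0<..<q}"
    then have "q dvd (q choose k)" using q by (intro dvd_choose_prime) auto
    then have "of_nat q * of_nat ((q choose k) div q) = (of_nat (q choose k) :: complex)"
      by (metis dvd_mult_div_cancel of_nat_mult)
    then show "of_nat q * (of_nat ((q choose k) div q) * a ^ k * b ^ (q - k))
        = of_nat (q choose k) * a ^ k * b ^ (q - k)"
      by (simp add: mult.assoc [symmetric])
  qed
  then show "(a + b) ^ q = a ^ q + b ^ q + of_nat q * ?c"
    using \<open>q > 0\<close> by (simp add: binomial_ring split)
qed

lemma frobenius_sum_mset:
  assumes q: "prime q" and h: "\<And>z. z \<in># h \<Longrightarrow> z \<in> int_adjoin \<zeta>"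
  shows "\<exists>c\<in>int_adjoin \<zeta>. (\<Sum>z\<in>#h. z ^ q) = sum_mset h ^ q + of_nat q * c"
  using h
proof (induction h)
  case empty
  show ?case using q prime_gt_0_nat [OF q] by (intro bexI [of _ 0]) (auto intro: int_adjoin_0)
next
  case (add x h)
  then obtain c where c: "c \<in> int_adjoin \<zeta>" "(\<Sum>z\<in>#h. z ^ q) = sum_mset h ^ q + of_nat q * c"
    by auto
  obtain d where d: "d \<in> int_adjoin \<zeta>"
      "(x + sum_mset h) ^ q = x ^ q + sum_mset h ^ q + of_nat q * d"
    using frobenius_add [OF q, of x \<zeta> "sum_mset h"] add.prems int_adjoin_sum_mset [of h \<zeta>] by auto
  show ?case
    using c d by (intro bexI [of _ "c - d"]) (auto simp: algebra_simps intro: int_adjoin_diff)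
qed

lemma root_of_unity_in_int_adjoin:
  assumes "N > 0" "z ^ N = 1"
  shows "z \<in> int_adjoin (cis (2 * pi / real N))"
proof -
  obtain k where "z = cis (2 * pi * real k / real N)"
    using bij_betw_imp_surj_on [OF bij_betw_roots_unity [OF assms(1)]] assms(2) by blast
  then have "z = cis (2 * pi / real N) ^ k"
    by (simp add: Complex.DeMoivre mult.commute)
  then show ?thesis by (simp add: int_adjoin_power int_adjoin_gen)
qed

text \<open>
By Frobenius, \<Sum> z^(qr) is congruent to (\<Sum> z^r)^q = 0 modulo q in \<int>[\<zeta>]. The
power sum depends on the exponent modulo N only, so it is one of finitely many numbers, and a
nonzero element of the ring is divisible by finitely many rational primes only: it divides a nonzero
integer c, and a rational algebraic integer is an integer, so q divides c.
\<close>

lemma power_sum_large_prime: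
  fixes h :: "complex multiset"
  assumes N: "N > 0" and h: "\<And>z. z \<in># h \<Longrightarrow> z ^ N = 1"
  shows "\<exists>B. \<forall>q r. prime q \<longrightarrow> q > B \<longrightarrow> (\<Sum>z\<in>#h. z ^ r) = 0 \<longrightarrow> (\<Sum>z\<in>#h. z ^ (q * r)) = 0"
proof -
  define \<zeta> where "\<zeta> = cis (2 * pi / real N)"
  define T where "T r = (\<Sum>z\<in>#h. z ^ r)" for r
  have \<zeta>: "\<zeta> ^ N = 1" using N by (simp add: \<zeta>_def Complex.DeMoivre)
  have span: "z ^ r \<in> int_adjoin \<zeta>" if "z \<in># h" for z r
    using root_of_unity_in_int_adjoin [OF N h [OF that]] by (auto simp: \<zeta>_def intro: int_adjoin_power)
  have T_span: "T r \<in> int_adjoin \<zeta>" for r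
    unfolding T_def by (rule int_adjoin_sum_mset) (auto intro: span)
  have T_mod: "T (r mod N) = T r" for r
    unfolding T_def by (intro arg_cong [of _ _ sum_mset] image_mset_cong) (simp add: root_of_unity_power_mod h)
  have "\<forall>r. \<exists>c::int. T r \<noteq> 0 \<longrightarrow> c \<noteq> 0 \<and> (\<exists>\<gamma>\<in>int_adjoin \<zeta>. T r * \<gamma> = of_int c)"
    using int_adjoin_divides_int [OF \<zeta> N T_span] by meson
  then obtain c :: "nat \<Rightarrow> int"
    where c: "\<And>r. T r \<noteq> 0 \<Longrightarrow> c r \<noteq> 0 \<and> (\<exists>\<gamma>\<in>int_adjoin \<zeta>. T r * \<gamma> = of_int (c r))"
    by metis
  define B where "B = Max ((\<lambda>r. nat \<bar>c r\<bar>) ` {..<N})"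
  have "T (q * r) = 0" if q: "prime q" "q > B" and r: "T r = 0" for q r
  proof (rule ccontr)
    define s where "s = (q * r) mod N"
    assume "T (q * r) \<noteq> 0"
    then have Ts: "T s \<noteq> 0" by (simp add: s_def T_mod)
    then obtain \<gamma> where \<gamma>: "c s \<noteq> 0" "\<gamma> \<in> int_adjoin \<zeta>" "T s * \<gamma> = of_int (c s)"
      using c by blast
    obtain d where d: "d \<in> int_adjoin \<zeta>"
        "(\<Sum>z\<in>#image_mset (\<lambda>z. z ^ r) h. z ^ q) = sum_mset (image_mset (\<lambda>z. z ^ r) h) ^ q + of_nat q * d"
      using frobenius_sum_mset [OF q(1), of "image_mset (\<lambda>z. z ^ r) h" \<zeta>] span by auto
    have "(\<Sum>z\<in>#image_mset (\<lambda>z. z ^ r) h. z ^ q) = T (q * r)"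
      by (simp add: T_def image_mset.compositionality comp_def power_mult [symmetric] mult.commute)
    with d r q(1) have "T s = of_nat q * d"
      by (simp add: s_def T_mod T_def [symmetric] prime_gt_0_nat power_0_left)
    with \<gamma> have "of_int (c s) / of_nat q = d * \<gamma>"
      using q(1) by (auto simp: field_simps)
    then have "algebraic_int (of_int (c s) / of_nat q :: complex)"
      using int_adjoin_algebraic_int [OF \<zeta> N int_adjoin_mult [OF d(1) \<gamma>(2)]] by simp
    then have "of_int (c s) / (of_nat q :: complex) \<in> \<int>"
      by (rule rational_algebraic_int_is_int) simp
    then obtain k :: int where "of_int (c s) / (of_nat q :: complex) = of_int k"
      by (auto elim: Ints_cases)
    then have "(of_int (c s) :: complex) = of_int (int q * k)"
      using prime_gt_0_nat [OF q(1)] by (simp add: field_simps)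
    then have "c s = int q * k" using of_int_eq_iff by blast
    then have "int q dvd \<bar>c s\<bar>" by simp
    then have "int q \<le> \<bar>c s\<bar>" using \<gamma>(1) by (intro zdvd_imp_le) auto
    moreover have "nat \<bar>c s\<bar> \<le> B"
      using N by (auto simp: B_def s_def intro!: Max_ge)
    ultimately show False using q(2) by linarith
  qed
  then show ?thesis unfolding T_def by blast
qed

text \<open>
Following Landau, r may be replaced by another number of its residue class modulo N all of whose
prime factors exceed the bound B of \<open>power_sum_large_prime\<close>, and these primes can be dealt with one at
a time. Dirichlet's theorem on primes in arithmetic progressions is thus avoided.
\<close>

lemma vanishing_power:
  fixes h :: "complex multiset"
  assumes N: "N > 0" and h: "\<And>z. z \<in># h \<Longrightarrow> z ^ N = 1"
    and van: "vanishing h" and r: "coprime r N"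
  shows "(\<Sum>z\<in>#h. z ^ r) = 0"
proof -
  obtain B where B: "\<And>q r. prime q \<Longrightarrow> q > B \<Longrightarrow> (\<Sum>z\<in>#h. z ^ r) = 0 \<Longrightarrow> (\<Sum>z\<in>#h. z ^ (q * r)) = 0"
    using power_sum_large_prime [OF N h] by metis
  define L where "L = \<Prod>{l. prime l \<and> l \<le> B \<and> \<not> l dvd r}"
  \<comment> \<open>A prime l \<le> B divides exactly one of r and NL, hence not s.\<close>
  define s where "s = r + N * L"
  have fin: "finite {l. prime l \<and> l \<le> B \<and> \<not> l dvd r}" by simp
  have *: "(\<Sum>z\<in>#h. z ^ m) = 0" if "m > 0" "\<And>l. prime l \<Longrightarrow> l dvd m \<Longrightarrow> l > B" for m
    using that
  proof (induction m rule: less_induct)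
    case (less m)
    show ?case
    proof (cases "m = 1")
      case True
      with van show ?thesis by (simp add: vanishing_def)
    next
      case False
      then obtain q where q: "prime q" "q dvd m" using prime_factor_nat by blast
      then obtain k where k: "m = q * k" by auto
      have "(\<Sum>z\<in>#h. z ^ k) = 0"
        using less.prems q(1) k prime_gt_1_nat [OF q(1)] by (intro less.IH) auto
      then show ?thesis
        using B [OF q(1)] less.prems(2) q k by simp
    qed
  qed
  have "L > 0" unfolding L_def by (rule prod_pos) (auto simp: prime_gt_0_nat)
  have big: "l > B" if l: "prime l" "l dvd s" for l
  proof (rule ccontr)
    assume "\<not> l > B"
    then have lB: "l \<le> B" by simp
    show False
    proof (cases "l dvd r")
      case True
      then have "\<not> l dvd N" using r l(1) by (meson coprime_common_divisor not_prime_unit)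
      moreover have "l dvd N * L" using l(2) True by (simp add: s_def dvd_add_right_iff)
      moreover have "\<not> l dvd L"
      proof
        assume "l dvd L"
        then obtain l' where "prime l'" "\<not> l' dvd r" "l dvd l'"
          unfolding L_def using prime_dvd_prod_iff [OF fin l(1)] by auto
        with l(1) True show False using primes_dvd_imp_eq by blast
      qed
      ultimately show False using l(1) by (simp add: prime_dvd_mult_iff)
    next
      case False
      then have "l dvd L" unfolding L_def using lB l(1) fin by (intro dvd_prodI) auto
      then have "l dvd r" using l(2) by (simp add: s_def dvd_add_left_iff)
      with False show False ..
    qed
  qed
  have "z ^ r = z ^ s" if "z \<in># h" for z
    using h [OF that] by (simp add: s_def power_add power_mult)
  then have "(\<Sum>z\<in>#h. z ^ r) = (\<Sum>z\<in>#h. z ^ s)"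
    by (intro arg_cong [of _ _ sum_mset] image_mset_cong)
  also have "\<dots> = 0"
    using N \<open>L > 0\<close> by (intro * big) (auto simp: s_def)
  finally show ?thesis .
qed

section \<open>Splitting a sum along a prime\<close>

text \<open>
Below, a constant factor is pulled out of a sum over a multiset; the simplification rule removed
here pushes it back in.
\<close>

declare mult_hom.hom_sum_mset [simp del]

lemma sum_mset_sum: "sum_mset (\<Sum>a\<in>A. f a) = (\<Sum>a\<in>A. sum_mset (f a))"
  for f :: "'b \<Rightarrow> 'a :: comm_monoid_add multiset"
  by (induction A rule: infinite_finite_induct) auto

lemma image_mset_sum_family: "image_mset k (\<Sum>a\<in>A. f a) = (\<Sum>a\<in>A. image_mset k (f a))"
  by (induction A rule: infinite_finite_induct) auto

lemma sum_family_mono: "(\<And>a. a \<in> A \<Longrightarrow> f a \<subseteq># g a) \<Longrightarrow> (\<Sum>a\<in>A. f a) \<subseteq># (\<Sum>a\<in>A. g a)"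
  for f :: "'b \<Rightarrow> 'a multiset"
  by (induction A rule: infinite_finite_induct) (auto intro: subset_mset.add_mono)

lemma sum_mset_sum_swap: "(\<Sum>k\<in>A. \<Sum>z\<in>#h. f k z) = (\<Sum>z\<in>#h. \<Sum>k\<in>A. f k z :: 'a :: comm_monoid_add)"
  by (induction h) (auto simp: sum.distrib)

lemma sum_mset_image_mult: "(\<Sum>z\<in>#h. c * z) = c * sum_mset h" for c :: "'a :: semiring_0"
  by (induction h) (auto simp: distrib_left)

lemma sum_mset_filter: "sum_mset (filter_mset P h) = (\<Sum>z\<in>#h. if P z then z else 0)"
  for h :: "'a :: comm_monoid_add multiset"
  by (induction h) auto

lemma count_image_mult: "c \<noteq> 0 \<Longrightarrow> count (image_mset ((*) c) h) z = count h (z / c)"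
  for c :: "'a :: field"
  by (induction h) (auto simp: field_simps)

lemma vanishing_image_mult [simp]: "c \<noteq> 0 \<Longrightarrow> vanishing (image_mset ((*) c) h) \<longleftrightarrow> vanishing h"
  by (simp add: vanishing_def sum_mset_image_mult)

lemma geometric_root_of_unity:
  fixes w :: complex
  assumes "w ^ p = 1"
  shows "(\<Sum>k<p. w ^ k) = (if w = 1 then of_nat p else 0)"
  using assms by (auto simp: geometric_sum)

lemma minimal_vanishing_vanishing: "minimal_vanishing h \<Longrightarrow> vanishing h"
  by (simp add: minimal_vanishing_def)

lemma minimal_vanishing_sub:
  "minimal_vanishing h \<Longrightarrow> g \<subseteq># h \<Longrightarrow> vanishing g \<Longrightarrow> g = {#} \<or> g = h"
  unfolding minimal_vanishing_def by (auto simp: subset_mset.less_le)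

lemma minimal_vanishing_image_mult:
  assumes "c \<noteq> 0" "minimal_vanishing h"
  shows "minimal_vanishing (image_mset ((*) c) h)"
  unfolding minimal_vanishing_def
proof (intro conjI allI impI)
  show "vanishing (image_mset ((*) c) h)" using assms by (simp add: minimal_vanishing_def)
  fix g assume g: "g \<subset># image_mset ((*) c) h \<and> g \<noteq> {#}"
  have "image_mset ((*) (inverse c)) g \<subset># image_mset ((*) (inverse c)) (image_mset ((*) c) h)"
    using g by (intro image_mset_subset_mono) auto
  also have "\<dots> = h" using assms(1) by (simp add: image_mset.compositionality comp_def mult.assoc [symmetric])
  finally show "\<not> vanishing g"
    using assms g unfolding minimal_vanishing_def
    by (metis image_mset_is_empty_iff inverse_nonzero_iff_nonzero vanishing_image_mult)
qed

text \<open>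
The parts of a reduced minimal vanishing sum have this property; adding the negated value to such a
multiset makes it a minimal vanishing sum (\<open>minimal_vanishing_add_negated_sum\<close>).
\<close>

definition zero_sum_free :: "complex multiset \<Rightarrow> bool" where
  "zero_sum_free f \<longleftrightarrow> (\<forall>g. g \<subseteq># f \<and> vanishing g \<longrightarrow> g = {#})"

definition part :: "nat \<Rightarrow> complex multiset \<Rightarrow> complex \<Rightarrow> complex multiset" where
  "part M h c = filter_mset (\<lambda>m. m ^ M = 1) (image_mset (\<lambda>z. z / c) h)"

abbreviation roots_of_one :: "nat \<Rightarrow> complex set" where
  "roots_of_one n \<equiv> {z. z ^ n = 1}"

lemma part_roots: "m \<in># part M h c \<Longrightarrow> m ^ M = 1"
  by (simp add: part_def)

lemma count_part: "c \<noteq> 0 \<Longrightarrow> count (part M h c) m = (if m ^ M = 1 then count h (c * m) else 0)"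
proof -
  have "(\<lambda>z. z / c) = (*) (inverse c)" by (auto simp: divide_inverse mult.commute)
  then show "c \<noteq> 0 \<Longrightarrow> ?thesis"
    using count_image_mult [of "inverse c" h m] by (simp add: part_def divide_inverse mult.commute)
qed

text \<open>
As p divides M, all exponents 1 + kM are coprime to pM, so that \<Sum> z * (z^M)^k = 0 for all k.
Here z^M is a p-th root of unity, and a discrete Fourier transform in k isolates the roots with
z^M = c.
\<close>

lemma square_class_vanishing:
  assumes p: "prime p" "p dvd M" and M: "M > 0"
    and h: "\<And>z. z \<in># h \<Longrightarrow> z ^ (p * M) = 1" and van: "vanishing h" and c: "c ^ p = 1"
  shows "vanishing (filter_mset (\<lambda>z. z ^ M = c) h)"
proof -
  have p0: "p > 0" using p prime_gt_0_nat by blast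
  have c0: "c \<noteq> 0" using c p0 by (auto simp: power_0_left)
  have zero: "(\<Sum>z\<in>#h. z ^ (1 + k * M)) = 0" for k
  proof (rule vanishing_power [OF _ h van])
    have "coprime (1 + k * M) M" using gcd_add_mult [of M k 1]
      by (simp add: coprime_iff_gcd_eq_1 gcd.commute)
    then show "coprime (1 + k * M) (p * M)"
      using p(2) by (meson coprime_divisors coprime_mult_right_iff dvd_refl)
  qed (use M p0 in auto)
  have "0 = (\<Sum>k<p. (1 / c) ^ k * (\<Sum>z\<in>#h. z ^ (1 + k * M)))" by (simp only: zero) simp
  also have "\<dots> = (\<Sum>z\<in>#h. \<Sum>k<p. z * (z ^ M / c) ^ k)"
    unfolding sum_mset_sum_swap [symmetric]
  proof (rule sum.cong)
    fix k
    have "(\<Sum>z\<in>#h. z * (z ^ M / c) ^ k) = (\<Sum>z\<in>#h. (1 / c) ^ k * z ^ (1 + k * M))"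
      by (intro arg_cong [of _ _ sum_mset] image_mset_cong)
        (simp add: power_divide power_mult [symmetric] mult.commute)
    also have "\<dots> = (1 / c) ^ k * (\<Sum>z\<in>#h. z ^ (1 + k * M))"
      by (simp only: sum_mset_distrib_left)
    finally show "(1 / c) ^ k * (\<Sum>z\<in>#h. z ^ (1 + k * M)) = (\<Sum>z\<in>#h. z * (z ^ M / c) ^ k)" by simp
  qed simp
  also have "\<dots> = (\<Sum>z\<in>#h. of_nat p * (if z ^ M = c then z else 0))"
  proof (intro arg_cong [of _ _ sum_mset] image_mset_cong)
    fix z assume "z \<in># h"
    then have "(z ^ M / c) ^ p = 1" using h [of z] c by (simp add: power_divide power_mult [symmetric] mult.commute)
    then have "(\<Sum>k<p. (z ^ M / c) ^ k) = (if z ^ M = c then of_nat p else 0)"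
      using geometric_root_of_unity [of "z ^ M / c" p] c0 by simp
    then show "(\<Sum>k<p. z * (z ^ M / c) ^ k) = of_nat p * (if z ^ M = c then z else 0)"
      by (simp add: sum_distrib_left [symmetric])
  qed
  also have "\<dots> = of_nat p * sum_mset (filter_mset (\<lambda>z. z ^ M = c) h)"
    by (simp add: sum_mset_filter sum_mset_distrib_left)
  finally show ?thesis using p0 by (simp add: vanishing_def)
qed

definition assemble :: "nat \<Rightarrow> (complex \<Rightarrow> complex multiset) \<Rightarrow> complex multiset" where
  "assemble p g = (\<Sum>c\<in>roots_of_one p. image_mset ((*) c) (g c))"

lemma size_assemble: "size (assemble p g) = (\<Sum>c\<in>roots_of_one p. size (g c))"
  by (simp add: assemble_def)

lemma sum_mset_assemble: "sum_mset (assemble p g) = (\<Sum>c\<in>roots_of_one p. c * sum_mset (g c))"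
  by (simp add: assemble_def sum_mset_sum sum_mset_image_mult)

text \<open>
Since p and M are coprime, \<mu>_pM is the direct product of \<mu>_p and \<mu>_M, and h falls
into parts indexed by \<mu>_p.
\<close>

locale prime_split =
  fixes p M :: nat and h :: "complex multiset"
  assumes p: "prime p" and cop: "coprime p M" and M: "M > 0"
    and roots: "\<And>z. z \<in># h \<Longrightarrow> z ^ (p * M) = 1"
begin

lemma p_pos: "p > 0"
  using p prime_gt_0_nat by blast

lemma class_nonzero: "c \<in> roots_of_one p \<Longrightarrow> c \<noteq> 0"
  using p_pos by (auto simp: power_0_left)

lemma finite_classes: "finite (roots_of_one p)" and card_classes: "card (roots_of_one p) = p"
  using p_pos finite_roots_unity [of p] card_roots_unity_eq [of p] by auto

lemma inj_power_classes: "inj_on (\<lambda>c. c ^ M) (roots_of_one p)"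
proof (rule inj_onI)
  fix c d assume *: "c \<in> roots_of_one p" "d \<in> roots_of_one p" "c ^ M = d ^ M"
  have w: "(c / d) ^ p = 1" "(c / d) ^ M = 1"
    using * class_nonzero by (auto simp: power_divide)
  obtain x y where xy: "M * x = p * y + 1"
    using bezout_nat [of M p] M cop by (auto simp: coprime_iff_gcd_eq_1 gcd.commute)
  have "c / d = (c / d) ^ (p * y + 1)" using w(1) by (simp add: power_add power_mult)
  also have "\<dots> = 1" using w(2) xy by (metis power_mult power_one)
  finally show "c = d" using class_nonzero * by simp
qed

lemma unique_class:
  assumes "z ^ (p * M) = 1"
  shows "\<exists>c. {c \<in> roots_of_one p. (z / c) ^ M = 1} = {c}"
proof -
  have "(\<lambda>c. c ^ M) ` roots_of_one p = roots_of_one p"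
    by (rule endo_inj_surj [OF finite_classes _ inj_power_classes])
      (auto, metis power_mult mult.commute power_one)
  moreover have "z ^ M \<in> roots_of_one p"
    using assms by (simp add: power_mult [symmetric] mult.commute)
  ultimately obtain c where c: "c \<in> roots_of_one p" "c ^ M = z ^ M" by (metis (lifting) image_iff)
  have "{c \<in> roots_of_one p. (z / c) ^ M = 1} = {d \<in> roots_of_one p. d ^ M = c ^ M}"
    using class_nonzero c by (auto simp: power_divide)
  also have "\<dots> = {c}" using c inj_power_classes by (auto simp: inj_on_def)
  finally show ?thesis by blast
qed

lemma assemble_part: "assemble p (part M h) = h"
proof (rule multiset_eqI)
  fix z
  have "count (assemble p (part M h)) z = (\<Sum>c\<in>roots_of_one p. count (image_mset ((*) c) (part M h c)) z)"
    by (simp add: assemble_def count_sum)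
  also have "\<dots> = (\<Sum>c\<in>roots_of_one p. if (z / c) ^ M = 1 then count h z else 0)"
    by (rule sum.cong) (use class_nonzero in \<open>auto simp: count_image_mult count_part\<close>)
  also have "\<dots> = (\<Sum>c\<in>{c\<in>roots_of_one p. (z / c) ^ M = 1}. count h z)"
    by (rule sum.inter_filter [OF finite_classes, symmetric])
  also have "\<dots> = count h z"
  proof (cases "z \<in># h")
    case True
    then obtain c where "{c \<in> roots_of_one p. (z / c) ^ M = 1} = {c}"
      using unique_class roots by blast
    then show ?thesis by (simp only:) simp
  qed (simp add: not_in_iff)
  finally show "count (assemble p (part M h)) z = count h z" .
qed

lemma size_parts: "size h = (\<Sum>c\<in>roots_of_one p. size (part M h c))"
  using size_assemble [of p "part M h"] by (simp add: assemble_part)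

lemma sum_power_parts:
  assumes "[r = 1] (mod M)"
  shows "(\<Sum>z\<in>#h. z ^ r) = (\<Sum>c\<in>roots_of_one p. c ^ r * sum_mset (part M h c))"
proof -
  have "(\<Sum>z\<in>#h. z ^ r) = (\<Sum>z\<in>#assemble p (part M h). z ^ r)" by (simp add: assemble_part)
  also have "\<dots> = (\<Sum>c\<in>roots_of_one p. \<Sum>m\<in>#part M h c. (c * m) ^ r)"
    unfolding assemble_def image_mset_sum_family sum_mset_sum
    by (simp add: image_mset.compositionality comp_def)
  also have "\<dots> = (\<Sum>c\<in>roots_of_one p. \<Sum>m\<in>#part M h c. c ^ r * m)"
  proof (intro sum.cong refl arg_cong [of _ _ sum_mset] image_mset_cong)
    fix c m assume "m \<in># part M h c"
    then have "m ^ M = 1" by (rule part_roots)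
    then have "m ^ r = m"
      using assms root_of_unity_power_mod [of m M r] root_of_unity_power_mod [of m M 1]
      by (simp add: cong_def)
    then show "(c * m) ^ r = c ^ r * m" by (simp add: power_mult_distrib)
  qed
  finally show ?thesis by (simp add: sum_mset_image_mult)
qed

text \<open>
An exponent r with r \<equiv> k modulo p and r \<equiv> 1 modulo M turns the relation
\<Sum> c * v_c = 0 between the values of the parts into \<Sum> c^k v_c = 0. This is available for
all k that are prime to p, so only the term k = 0 of the discrete Fourier transform of
c \<mapsto> v_c survives, and v is constant.
\<close>

lemma part_value_const:
  assumes van: "vanishing h" and cd: "c \<in> roots_of_one p" "d \<in> roots_of_one p"
  shows "sum_mset (part M h c) = sum_mset (part M h d)"
proof -
  define v where "v c = sum_mset (part M h c)" for c
  have zero: "(\<Sum>c\<in>roots_of_one p. c ^ k * v c) = 0" if k: "\<not> p dvd k" for k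
  proof -
    obtain r where r: "[r = k] (mod p)" "[r = 1] (mod M)"
      using binary_chinese_remainder_nat [OF cop] by blast
    have "coprime r p"
      using k p r(1) by (metis cong_dvd_iff coprime_commute prime_imp_coprime)
    moreover have "coprime r M" using r(2) cong_imp_coprime cong_sym coprime_1_left by blast
    ultimately have "(\<Sum>z\<in>#h. z ^ r) = 0"
      using M p_pos roots van by (intro vanishing_power [where N = "p * M"]) auto
    then have "(\<Sum>c\<in>roots_of_one p. c ^ r * v c) = 0"
      by (simp add: sum_power_parts [OF r(2)] v_def)
    moreover have "c ^ r = c ^ k" if "c \<in> roots_of_one p" for c
      using r(1) that root_of_unity_power_mod [of c p r] root_of_unity_power_mod [of c p k]
      by (simp add: cong_def)
    ultimately show ?thesis by simp
  qed
  have "of_nat p * v d = (\<Sum>c\<in>roots_of_one p. v c)" if d: "d \<in> roots_of_one p" for d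
  proof -
    have d0: "d \<noteq> 0" using class_nonzero d by blast
    have "(\<Sum>c\<in>roots_of_one p. v c) = (\<Sum>k<p. (1 / d) ^ k * (\<Sum>c\<in>roots_of_one p. c ^ k * v c))"
    proof -
      have "(1 / d) ^ k * (\<Sum>c\<in>roots_of_one p. c ^ k * v c) = 0" if "k \<in> {..<p} - {0}" for k
        using zero [of k] that dvd_imp_le [of p k] by auto
      then have "(\<Sum>k<p. (1 / d) ^ k * (\<Sum>c\<in>roots_of_one p. c ^ k * v c))
          = (\<Sum>k\<in>{0}. (1 / d) ^ k * (\<Sum>c\<in>roots_of_one p. c ^ k * v c))"
        using p_pos by (intro sum.mono_neutral_right) auto
      then show ?thesis by simp
    qed
    also have "\<dots> = (\<Sum>c\<in>roots_of_one p. v c * (\<Sum>k<p. (c / d) ^ k))"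
      unfolding sum_distrib_left by (subst sum.swap) (simp add: power_divide mult_ac)
    also have "\<dots> = (\<Sum>c\<in>roots_of_one p. if c = d then of_nat p * v d else 0)"
    proof (rule sum.cong)
      fix c assume "c \<in> roots_of_one p"
      then have "(c / d) ^ p = 1" using d by (simp add: power_divide)
      then show "v c * (\<Sum>k<p. (c / d) ^ k) = (if c = d then of_nat p * v d else 0)"
        using geometric_root_of_unity [of "c / d" p] d0 by auto
    qed simp
    also have "\<dots> = of_nat p * v d" using d finite_classes by simp
    finally show ?thesis by simp
  qed
  from this [OF cd(1)] this [OF cd(2)] have "of_nat p * v c = of_nat p * v d" by simp
  then show ?thesis using p_pos by (simp add: v_def)
qed

lemma assemble_subset:
  assumes "\<And>c. c \<in> roots_of_one p \<Longrightarrow> g c \<subseteq># part M h c"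
  shows "assemble p g \<subseteq># h"
proof -
  have "assemble p g \<subseteq># assemble p (part M h)"
    unfolding assemble_def by (intro sum_family_mono image_mset_subseteq_mono assms)
  then show ?thesis by (simp add: assemble_part)
qed

text \<open>
The reassembled sum has value u * \<Sum> c = 0, so it is empty or all of h. This is the way in
which minimality is used throughout.
\<close>

lemma equal_subvalues:
  assumes min: "minimal_vanishing h"
    and g: "\<And>c. c \<in> roots_of_one p \<Longrightarrow> g c \<subseteq># part M h c"
    and u: "\<And>c. c \<in> roots_of_one p \<Longrightarrow> sum_mset (g c) = u"
  shows "(\<forall>c\<in>roots_of_one p. g c = {#}) \<or> (\<forall>c\<in>roots_of_one p. g c = part M h c)"
proof -
  have "sum_mset (assemble p g) = (\<Sum>c\<in>roots_of_one p. c * u)"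
    by (simp add: sum_mset_assemble u)
  also have "\<dots> = 0"
    using sum_roots_unity [of p] prime_gt_1_nat [OF p] by (simp add: sum_distrib_right [symmetric])
  finally have "vanishing (assemble p g)" by (simp add: vanishing_def)
  then consider "assemble p g = {#}" | "assemble p g = h"
    using minimal_vanishing_sub [OF min assemble_subset [OF g]] by blast
  then show ?thesis
  proof cases
    case 1
    then have "(\<Sum>c\<in>roots_of_one p. size (g c)) = 0" by (metis size_assemble size_empty)
    then show ?thesis using finite_classes by auto
  next
    case 2
    then have "(\<Sum>c\<in>roots_of_one p. size (g c)) = (\<Sum>c\<in>roots_of_one p. size (part M h c))"
      by (metis size_assemble size_parts)
    then have "size (g c) = size (part M h c)" if "c \<in> roots_of_one p" for c
      using that finite_classes g by (intro sum_mono_inv [where f = "\<lambda>c. size (g c)"]) (auto intro: size_mset_mono)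
    then show ?thesis
      using g by (metis mset_subset_size subset_mset.le_imp_less_or_eq less_irrefl)
  qed
qed

lemma vanishing_subpart:
  assumes min: "minimal_vanishing h" and c: "c \<in> roots_of_one p"
    and g: "g \<subseteq># part M h c" "vanishing g" "g \<noteq> {#}"
  shows "h = image_mset ((*) c) g"
proof -
  define g' where "g' = (\<lambda>d. if d = c then g else {#})"
  have "assemble p g' = (\<Sum>d\<in>roots_of_one p. if d = c then image_mset ((*) c) g else {#})"
    unfolding assemble_def g'_def by (rule sum.cong) auto
  also have "\<dots> = image_mset ((*) c) g" using c finite_classes by simp
  finally have "assemble p g' = image_mset ((*) c) g" .
  moreover have "assemble p g' \<subseteq># h" by (rule assemble_subset) (use g in \<open>auto simp: g'_def\<close>)
  ultimately show ?thesis
    using minimal_vanishing_sub [OF min, of "image_mset ((*) c) g"] g class_nonzero [OF c] by auto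
qed

end

section \<open>Reduction to square-free order\<close>

text \<open>
The least order to which a sum can be brought by a rotation. The factor \<open>a\<close> ranges over
all nonzero numbers, because multiplication by anything but a root of unity takes h out of every
\<mu>_K.
\<close>

definition reduced :: "nat \<Rightarrow> complex multiset \<Rightarrow> bool" where
  "reduced N h \<longleftrightarrow> N > 0 \<and> (\<forall>z\<in>#h. z ^ N = 1) \<and>
     (\<forall>K a. 0 < K \<and> K < N \<and> a \<noteq> 0 \<longrightarrow> \<not> (\<forall>z\<in>#h. (a * z) ^ K = 1))"

lemma common_root_order:
  assumes "\<forall>z\<in>#h. root_of_unity z"
  shows "\<exists>N>0. \<forall>z\<in>#h. z ^ N = 1"
  using assms
proof (induction h)
  case empty
  show ?case by (auto intro: exI [of _ 1])
next
  case (add x h)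
  then obtain N n where N: "N > 0" "\<forall>z\<in>#h. z ^ N = 1" and n: "n > 0" "x ^ n = 1"
    by (auto simp: root_of_unity_def)
  have "\<forall>z\<in>#add_mset x h. z ^ (N * n) = 1"
    using N n by (auto simp: power_mult) (metis mult.commute power_mult power_one)
  then show ?case using N n by (intro exI [of _ "N * n"]) auto
qed

lemma reduced_rotation_exists:
  assumes "\<forall>z\<in>#h. root_of_unity z"
  shows "\<exists>N a. a \<noteq> 0 \<and> reduced N (image_mset ((*) a) h)"
proof -
  define Q where "Q N \<longleftrightarrow> N > 0 \<and> (\<exists>a. a \<noteq> 0 \<and> (\<forall>z\<in>#h. (a * z) ^ N = 1))" for N
  obtain N where "Q N"
    using common_root_order [OF assms] unfolding Q_def by (metis mult_1 one_neq_zero)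
  define N\<^sub>0 where "N\<^sub>0 = (LEAST N. Q N)"
  have Q: "Q N\<^sub>0" using \<open>Q N\<close> unfolding N\<^sub>0_def by (rule LeastI)
  then obtain a where a: "a \<noteq> 0" "\<forall>z\<in>#h. (a * z) ^ N\<^sub>0 = 1"
    by (auto simp: Q_def)
  have "reduced N\<^sub>0 (image_mset ((*) a) h)"
    unfolding reduced_def
  proof (intro conjI allI impI notI)
    show "N\<^sub>0 > 0" using Q by (simp add: Q_def)
    show "\<forall>z\<in>#image_mset ((*) a) h. z ^ N\<^sub>0 = 1" using a by simp
    fix K b
    assume K: "0 < K \<and> K < N\<^sub>0 \<and> b \<noteq> 0"
      and "\<forall>z\<in>#image_mset ((*) a) h. (b * z) ^ K = 1"
    then have "Q K" using a(1) unfolding Q_def by (auto intro!: exI [of _ "b * a"] simp: mult.assoc)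
    with K show False unfolding N\<^sub>0_def using not_less_Least by blast
  qed
  with a(1) show ?thesis by blast
qed

text \<open>
If p divides M, the roots of h all have the same power z^M, by minimality and
\<open>square_class_vanishing\<close>; dividing by one of them moves h into \<mu>_M.
\<close>

lemma reduced_prime_not_dvd:
  assumes red: "reduced N h" and min: "minimal_vanishing h" and ne: "h \<noteq> {#}"
    and p: "prime p" and N: "N = p * M"
  shows "\<not> p dvd M"
proof
  assume pM: "p dvd M"
  have "M > 0" "M < N" using N red prime_gt_1_nat [OF p] by (auto simp: reduced_def)
  have roots: "z ^ (p * M) = 1" if "z \<in># h" for z
    using red that N by (simp add: reduced_def)
  obtain z where z: "z \<in># h" using ne by auto
  define c where "c = z ^ M"
  have "c ^ p = 1" using roots [OF z] by (simp add: c_def power_mult [symmetric] mult.commute)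
  then have "vanishing (filter_mset (\<lambda>z. z ^ M = c) h)"
    using square_class_vanishing [OF p pM \<open>M > 0\<close> roots minimal_vanishing_vanishing [OF min]] by blast
  moreover have "z \<in># filter_mset (\<lambda>z. z ^ M = c) h" using z by (simp add: c_def)
  ultimately have "filter_mset (\<lambda>z. z ^ M = c) h = h"
    using minimal_vanishing_sub [OF min, of "filter_mset (\<lambda>z. z ^ M = c) h"] by auto
  then have cl: "y ^ M = c" if "y \<in># h" for y
    using that by (metis (mono_tags, lifting) filter_mset_eq_conv)
  have "z \<noteq> 0" using roots [OF z] \<open>M > 0\<close> p by (auto simp: power_0_left)
  then have "z ^ M \<noteq> 0" by simp
  then have "\<forall>y\<in>#h. (1 / z * y) ^ M = 1"
    by (simp add: power_divide cl [OF z] cl)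
  then show False
    using red \<open>M > 0\<close> \<open>M < N\<close> \<open>z \<noteq> 0\<close> unfolding reduced_def by (metis divide_eq_0_iff one_neq_zero)
qed

lemma reduced_prime_split:
  assumes red: "reduced N h" and min: "minimal_vanishing h" and ne: "h \<noteq> {#}"
    and p: "prime p" and N: "N = p * M"
  shows "prime_split p M h"
proof
  show "prime p" by fact
  show "coprime p M"
    using reduced_prime_not_dvd [OF red min ne p N] p by (simp add: prime_imp_coprime)
qed (use red N in \<open>auto simp: reduced_def\<close>)

text \<open>
If the parts vanish, then by minimality there is only one nonempty part, and h can be rotated into
\<mu>_M.
\<close>

lemma reduced_part_value_nonzero:
  assumes red: "reduced N h" and min: "minimal_vanishing h" and ne: "h \<noteq> {#}"
    and p: "prime p" and N: "N = p * M" and c: "c \<in> roots_of_one p"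
  shows "sum_mset (part M h c) \<noteq> 0"
proof
  interpret prime_split p M h using reduced_prime_split [OF red min ne p N] .
  assume "sum_mset (part M h c) = 0"
  then have zero: "vanishing (part M h d)" if "d \<in> roots_of_one p" for d
    using part_value_const [OF minimal_vanishing_vanishing [OF min] c that] by (simp add: vanishing_def)
  have "\<exists>d\<in>roots_of_one p. part M h d \<noteq> {#}"
  proof (rule ccontr)
    assume "\<not> ?thesis"
    then have "size h = 0" using size_parts by simp
    with ne show False by simp
  qed
  then obtain d where d: "d \<in> roots_of_one p" "part M h d \<noteq> {#}" by blast
  have h: "h = image_mset ((*) d) (part M h d)"
    by (rule vanishing_subpart [OF min d(1) _ zero [OF d(1)] d(2)]) simp
  have "\<forall>z\<in>#h. (1 / d * z) ^ M = 1"
    using class_nonzero [OF d(1)] by (subst h) (auto dest: part_roots)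
  moreover have "M < N" using N M prime_gt_1_nat [OF p] by simp
  ultimately show False
    using red M class_nonzero [OF d(1)] unfolding reduced_def by (metis divide_eq_0_iff one_neq_zero)
qed

section \<open>Sums of sixth roots of unity\<close>

text \<open>
The primitive sixth root of unity in the first quadrant; the hexagon of sixth roots is
1, \<eta>, \<eta> - 1, -1, -\<eta>, 1 - \<eta> in this order.
\<close>

definition \<eta> :: complex where
  "\<eta> = Complex (1 / 2) (sqrt 3 / 2)"

lemma eta_sq: "\<eta> * \<eta> = \<eta> - 1"
  by (simp add: \<eta>_def complex_eq_iff)

lemma eta_sq_mult: "\<eta> * (\<eta> * x) = \<eta> * x - x"
  using arg_cong [OF eta_sq, of "\<lambda>y. y * x"] by (simp add: algebra_simps)

lemma eta_neq: "\<eta> \<noteq> 0" "\<eta> \<noteq> 1" "\<eta> \<noteq> -1" "\<eta> - 1 \<noteq> 1" "\<eta> - 1 \<noteq> -1" "\<eta> - 1 \<noteq> \<eta>" "\<eta> - 1 \<noteq> - \<eta>"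
  "1 - \<eta> \<noteq> \<eta>" "1 - \<eta> \<noteq> -1" "1 - \<eta> \<noteq> 1" "1 - \<eta> \<noteq> \<eta> - 1" "- \<eta> \<noteq> \<eta>" "- \<eta> \<noteq> 1" "- \<eta> \<noteq> -1" "1 - \<eta> \<noteq> - \<eta>"
  "(-1 :: complex) \<noteq> 1"
  by (auto simp: \<eta>_def complex_eq_iff)

lemma sixth_roots: "z ^ 6 = 1 \<longleftrightarrow> z \<in> {1, \<eta>, \<eta> - 1, -1, -\<eta>, 1 - \<eta>}"
proof -
  have "(z - 1) * (z - \<eta>) * (z - (\<eta> - 1)) * (z + 1) * (z + \<eta>) * (z - (1 - \<eta>)) = z ^ 6 - 1"
    by (simp add: algebra_simps eval_nat_numeral eta_sq eta_sq_mult)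
  then have "z ^ 6 = 1 \<longleftrightarrow> (z - 1) * (z - \<eta>) * (z - (\<eta> - 1)) * (z + 1) * (z + \<eta>) * (z - (1 - \<eta>)) = 0"
    by simp
  also have "\<dots> \<longleftrightarrow> z \<in> {1, \<eta>, \<eta> - 1, -1, -\<eta>, 1 - \<eta>}"
    by (auto simp: eq_neg_iff_add_eq_0)
  finally show ?thesis .
qed

lemma eisenstein_independent:
  assumes "of_int a + of_int b * \<eta> = of_int c + of_int d * \<eta>"
  shows "a = c" "b = d"
proof -
  have "real_of_int a + real_of_int b / 2 = real_of_int c + real_of_int d / 2"
    "real_of_int b * (sqrt 3 / 2) = real_of_int d * (sqrt 3 / 2)"
    using assms by (simp_all add: complex_eq_iff \<eta>_def)
  then show "a = c" "b = d" by simp_all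
qed

lemma sixth_roots_value:
  assumes "\<And>z. z \<in># f \<Longrightarrow> z ^ 6 = 1"
  shows "sum_mset f =
    of_int (int (count f 1) - int (count f (-1)) - int (count f (\<eta> - 1)) + int (count f (1 - \<eta>)))
    + of_int (int (count f \<eta>) - int (count f (-\<eta>)) + int (count f (\<eta> - 1)) - int (count f (1 - \<eta>))) * \<eta>"
  using assms
proof (induction f)
  case (add x f)
  then have x: "x \<in> {1, \<eta>, \<eta> - 1, -1, -\<eta>, 1 - \<eta>}" using sixth_roots by auto
  have IH: "sum_mset f =
    of_int (int (count f 1) - int (count f (-1)) - int (count f (\<eta> - 1)) + int (count f (1 - \<eta>)))
    + of_int (int (count f \<eta>) - int (count f (-\<eta>)) + int (count f (\<eta> - 1)) - int (count f (1 - \<eta>))) * \<eta>"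
    using add by simp
  from x show ?case
    by (elim insertE emptyE; hypsubst)
      (simp_all only: sum_mset.add_mset count_add_mset eta_neq eta_neq [symmetric] if_True if_False
        simp_thms IH, simp_all add: algebra_simps)
qed simp

text \<open>
Without 1, the coordinate a > 0 can only come from 1 - \<eta>, which lowers the other coordinate.
To bring that back to b \<ge> 0 takes \<eta> or \<eta> - 1, but \<eta> - 1 lowers the first
coordinate by as much as it raises the second, so that it alone does not suffice.
\<close>

lemma hexagon_reduction:
  assumes f: "\<And>z. z \<in># f \<Longrightarrow> z ^ 6 = 1" and val: "sum_mset f = of_int a + of_int b * \<eta>"
    and ab: "a > 0" "b \<ge> 0"
  shows "1 \<in># f \<or> \<eta> \<in># f \<and> 1 - \<eta> \<in># f"
proof -
  have "int (count f 1) - int (count f (-1)) - int (count f (\<eta> - 1)) + int (count f (1 - \<eta>)) = a"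
    "int (count f \<eta>) - int (count f (-\<eta>)) + int (count f (\<eta> - 1)) - int (count f (1 - \<eta>)) = b"
    using eisenstein_independent sixth_roots_value [OF f] val by metis+
  with ab have "count f 1 > 0 \<or> count f \<eta> > 0 \<and> count f (1 - \<eta>) > 0" by linarith
  then show ?thesis by simp
qed

text \<open>
The six rotations of the half-open cone spanned by 1 and \<eta> cover the plane without the origin.
\<close>

lemma eisenstein_sector:
  fixes a b :: int
  assumes "(a, b) \<noteq> (0, 0)"
  shows "\<exists>e c d. e ^ 6 = 1 \<and> c > 0 \<and> d \<ge> 0 \<and>
    of_int a + of_int b * \<eta> = e * (of_int c + of_int d * \<eta>)"
proof -
  have *: ?thesis if "e \<in> {1, \<eta>, \<eta> - 1, -1, -\<eta>, 1 - \<eta>}" "c > 0" "d \<ge> 0"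
      "of_int a + of_int b * \<eta> = e * (of_int c + of_int d * \<eta>)" for e c d
    using that sixth_roots by blast
  consider "a > 0" "b \<ge> 0" | "a \<le> 0" "a + b > 0" | "b > 0" "a + b \<le> 0"
    | "a < 0" "b \<le> 0" | "a \<ge> 0" "a + b < 0" | "b < 0" "a + b \<ge> 0"
    using assms by fastforce
  then show ?thesis
  proof cases
    case 1 then show ?thesis by (intro * [of 1 a b]) auto
  next
    case 2
    have "of_int a + of_int b * \<eta> = \<eta> * (of_int (a + b) + of_int (- a) * \<eta>)"
      by (simp add: algebra_simps eta_sq eta_sq_mult)
    then show ?thesis using 2 by (intro * [of "\<eta>" "a + b" "- a"]) auto
  next
    case 3
    have "of_int a + of_int b * \<eta> = (\<eta> - 1) * (of_int (b) + of_int (- a - b) * \<eta>)"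
      by (simp add: algebra_simps eta_sq eta_sq_mult)
    then show ?thesis using 3 by (intro * [of "(\<eta> - 1)" "b" "- a - b"]) auto
  next
    case 4
    have "of_int a + of_int b * \<eta> = (- 1) * (of_int (- a) + of_int (- b) * \<eta>)"
      by simp
    then show ?thesis using 4 by (intro * [of "(- 1)" "- a" "- b"]) auto
  next
    case 5
    have "of_int a + of_int b * \<eta> = (- \<eta>) * (of_int (- a - b) + of_int (a) * \<eta>)"
      by (simp add: algebra_simps eta_sq eta_sq_mult)
    then show ?thesis using 5 by (intro * [of "(- \<eta>)" "- a - b" "a"]) auto
  next
    case 6
    have "of_int a + of_int b * \<eta> = (1 - \<eta>) * (of_int (- b) + of_int (a + b) * \<eta>)"
      by (simp add: algebra_simps eta_sq eta_sq_mult)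
    then show ?thesis using 6 by (intro * [of "(1 - \<eta>)" "- b" "a + b"]) auto
  qed
qed

text \<open>
A nonzero value determines a sixth root of unity e such that every sum of sixth roots with this value
contains a subsum of value e of one of two shapes: e itself, or its two neighbours in the hexagon.
\<close>

lemma common_sixth_root:
  assumes f: "\<And>z. z \<in># f \<Longrightarrow> z ^ 6 = 1" and nz: "sum_mset f \<noteq> 0"
  shows "\<exists>e. e ^ 6 = 1 \<and> (\<forall>g. (\<forall>z\<in>#g. z ^ 6 = 1) \<and> sum_mset g = sum_mset f \<longrightarrow>
     {#e#} \<subseteq># g \<or> {#e * \<eta>, e * (1 - \<eta>)#} \<subseteq># g)"
proof -
  obtain a b :: int where ab: "sum_mset f = of_int a + of_int b * \<eta>"
    using sixth_roots_value [OF f] by blast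
  with nz have "(a, b) \<noteq> (0, 0)" by auto
  then obtain e c d where e: "e ^ 6 = 1" "c > 0" "d \<ge> 0"
      "sum_mset f = e * (of_int c + of_int d * \<eta>)"
    using eisenstein_sector unfolding ab by blast
  have e0: "e \<noteq> 0" using e(1) by auto
  have "{#e#} \<subseteq># g \<or> {#e * \<eta>, e * (1 - \<eta>)#} \<subseteq># g"
    if g: "\<forall>z\<in>#g. z ^ 6 = 1" "sum_mset g = sum_mset f" for g
  proof -
    define k where "k = image_mset ((*) (1 / e)) g"
    have ek: "image_mset ((*) e) k = g"
      using e0 by (simp add: k_def image_mset.compositionality comp_def)
    have "sum_mset k = of_int c + of_int d * \<eta>"
      using e0 e(4) g(2) unfolding k_def sum_mset_image_mult by simp
    moreover have "z ^ 6 = 1" if "z \<in># k" for z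
      using that g(1) e(1) by (auto simp: k_def power_divide)
    ultimately have "1 \<in># k \<or> \<eta> \<in># k \<and> 1 - \<eta> \<in># k"
      using hexagon_reduction e(2,3) by blast
    then have "{#1#} \<subseteq># k \<or> {#\<eta>, 1 - \<eta>#} \<subseteq># k"
      using eta_neq by (auto simp: insert_subset_eq_iff in_diff_count)
    then have "image_mset ((*) e) {#1#} \<subseteq># g \<or> image_mset ((*) e) {#\<eta>, 1 - \<eta>#} \<subseteq># g"
      using image_mset_subseteq_mono ek by metis
    then show ?thesis by simp
  qed
  with e(1) show ?thesis by blast
qed

text \<open>
A minimal vanishing sum of sixth roots is an antipodal pair or an equilateral triangle.
\<close>

lemma minimal_sixth_roots:
  assumes f: "\<And>z. z \<in># f \<Longrightarrow> z ^ 6 = 1" and min: "minimal_vanishing f"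
    and mm: "{#m, m'#} \<subseteq># f"
  shows "m' = - m \<and> size f = 2 \<or> m' / m \<in> {\<eta> - 1, -\<eta>} \<and> size f = 3"
proof -
  have m: "m \<in># f" using mm by (metis insert_subset_eq_iff)
  then have m0: "m \<noteq> 0" "m ^ 6 = 1" using f [OF m] by auto
  define k where "k = image_mset ((*) (1 / m)) f"
  have k: "z ^ 6 = 1" if "z \<in># k" for z
    using that f m0 by (auto simp: k_def power_divide)
  have mink: "minimal_vanishing k"
    unfolding k_def using m0 by (intro minimal_vanishing_image_mult min) auto
  have sub: "{#1, m' / m#} \<subseteq># k"
    using image_mset_subseteq_mono [OF mm, of "(*) (1 / m)"] m0 by (simp add: k_def)
  then have one: "count k 1 > 0" by (simp add: insert_subset_eq_iff)
  have "sum_mset k = of_int 0 + of_int 0 * \<eta>"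
    using mink by (simp add: minimal_vanishing_def vanishing_def)
  then have zero: "int (count k 1) - int (count k (-1)) - int (count k (\<eta> - 1)) + int (count k (1 - \<eta>)) = 0"
    "int (count k \<eta>) - int (count k (-\<eta>)) + int (count k (\<eta> - 1)) - int (count k (1 - \<eta>)) = 0"
    using eisenstein_independent sixth_roots_value [of k] k by metis+
  show ?thesis
  proof (cases "-1 \<in># k")
    case True
    then have "{#1, -1#} \<subseteq># k" using one by (auto simp: insert_subset_eq_iff in_diff_count)
    then have "k = {#1, -1#}"
      using minimal_vanishing_sub [OF mink, of "{#1, -1#}"] by (simp add: vanishing_def)
    then show ?thesis using sub m0 by (auto simp: k_def field_simps size_image_mset dest: arg_cong [of _ _ size])
  next
    case False
    then have "count k (-1) = 0" by (simp add: not_in_iff)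
    with zero one have "count k (\<eta> - 1) > 0" "count k (-\<eta>) > 0" by linarith+
    then have "{#1, \<eta> - 1, -\<eta>#} \<subseteq># k"
      using one eta_neq by (auto simp: insert_subset_eq_iff in_diff_count)
    then have "k = {#1, \<eta> - 1, -\<eta>#}"
      using minimal_vanishing_sub [OF mink, of "{#1, \<eta> - 1, -\<eta>#}"] by (simp add: vanishing_def)
    moreover from this have "size f = 3" by (simp add: k_def) (metis size_image_mset size_add_mset size_empty numeral_3_eq_3)
    ultimately show ?thesis using sub by (auto simp: insert_subset_eq_iff)
  qed
qed

section \<open>Minimal vanishing sums of thirtieth roots of unity\<close>

text \<open>
The powers 15, 10 and 6 project \<mu>_30 to its components of orders 2, 3 and 5. So the lines speak
of the orders 2, 3, 5, 30 and 15, in this order; quotients of order 1, 6 or 10 are ruled out. The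
encoding by powers makes the behaviour under products visible.
\<close>

definition ratio_in_weight :: "complex \<Rightarrow> nat \<Rightarrow> bool" where
  "ratio_in_weight z n \<longleftrightarrow>
     z ^ 15 \<noteq> 1 \<and> z ^ 10 = 1 \<and> z ^ 6 = 1 \<and> n \<ge> 2 \<or>
     z ^ 15 = 1 \<and> z ^ 10 \<noteq> 1 \<and> z ^ 6 = 1 \<and> n \<ge> 3 \<or>
     z ^ 15 = 1 \<and> z ^ 10 = 1 \<and> z ^ 6 \<noteq> 1 \<and> n \<ge> 5 \<or>
     z ^ 15 \<noteq> 1 \<and> z ^ 10 \<noteq> 1 \<and> z ^ 6 \<noteq> 1 \<and> n \<ge> 6 \<or>
     z ^ 15 = 1 \<and> z ^ 10 \<noteq> 1 \<and> z ^ 6 \<noteq> 1 \<and> n \<ge> 7"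

text \<open>
In each of the three components, if one of r, t is trivial then the other agrees with rt in
being trivial or not; in the component of order 2 exactly one or all three of r, t, rt are
trivial. The combinations of lines that this leaves are
(2,15,30), (3,5,15), (3,30,30), (5,5,5), and ones with larger weights, apart from three
elements of order 3.
\<close>

lemma ratio_triangle:
  assumes roots: "r ^ 30 = 1" "t ^ 30 = 1"
    and w: "ratio_in_weight r n" "ratio_in_weight t m" "ratio_in_weight (r * t) k"
  shows "n + m + k \<ge> 15 \<or>
    (\<forall>z\<in>{r, t, r * t}. z ^ 15 = 1 \<and> z ^ 10 \<noteq> 1 \<and> z ^ 6 = 1)"
proof -
  have "r ^ 15 * r ^ 15 = 1" "t ^ 15 * t ^ 15 = 1"
    using roots by (simp_all flip: power_add)
  then have sgn: "r ^ 15 = 1 \<or> r ^ 15 = -1" "t ^ 15 = 1 \<or> t ^ 15 = -1"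
    by (simp_all only: square_eq_1_iff)
  have A: "(r * t) ^ 15 = 1 \<longleftrightarrow> (r ^ 15 = 1 \<longleftrightarrow> t ^ 15 = 1)"
    using sgn by (auto simp: power_mult_distrib)
  have B: "r ^ 10 = 1 \<Longrightarrow> (r * t) ^ 10 = 1 \<longleftrightarrow> t ^ 10 = 1" "t ^ 10 = 1 \<Longrightarrow> (r * t) ^ 10 = 1 \<longleftrightarrow> r ^ 10 = 1"
    by (auto simp: power_mult_distrib)
  have C: "r ^ 6 = 1 \<Longrightarrow> (r * t) ^ 6 = 1 \<longleftrightarrow> t ^ 6 = 1" "t ^ 6 = 1 \<Longrightarrow> (r * t) ^ 6 = 1 \<longleftrightarrow> r ^ 6 = 1"
    by (auto simp: power_mult_distrib)
  define rA rB rC tA tB tC sA sB sC where defs: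
    "rA \<longleftrightarrow> r ^ 15 = 1" "rB \<longleftrightarrow> r ^ 10 = 1" "rC \<longleftrightarrow> r ^ 6 = 1"
    "tA \<longleftrightarrow> t ^ 15 = 1" "tB \<longleftrightarrow> t ^ 10 = 1" "tC \<longleftrightarrow> t ^ 6 = 1"
    "sA \<longleftrightarrow> (r * t) ^ 15 = 1" "sB \<longleftrightarrow> (r * t) ^ 10 = 1" "sC \<longleftrightarrow> (r * t) ^ 6 = 1"
  show ?thesis
    using w A B C unfolding ratio_in_weight_def ball_simps defs [symmetric]
    by (elim disjE conjE) simp_all
qed

lemma eta_powers: "\<eta> ^ 3 = -1" "(1 - \<eta>) ^ 3 = -1" "(\<eta> - 1) ^ 3 = 1" "(- \<eta>) ^ 3 = 1"
  by (simp_all add: power3_eq_cube algebra_simps eta_sq eta_sq_mult)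

lemma ratio_order_three:
  assumes "z \<in> {\<eta> - 1, - \<eta>}" "n \<ge> 3"
  shows "ratio_in_weight z n"
proof -
  have z3: "z ^ 3 = 1" using assms(1) eta_powers by auto
  have "z \<noteq> 1" using assms(1) eta_neq by auto
  have "z ^ 15 = (z ^ 3) ^ 5" "z ^ 10 = (z ^ 3) ^ 3 * z" "z ^ 6 = (z ^ 3) ^ 2"
    by (simp_all flip: power_mult add: power_Suc2 [symmetric] del: power_Suc)
  then have "z ^ 15 = 1" "z ^ 10 \<noteq> 1" "z ^ 6 = 1" using z3 \<open>z \<noteq> 1\<close> by simp_all
  then show ?thesis using assms(2) by (simp add: ratio_in_weight_def)
qed

text \<open>
For roots in two different classes modulo the fifth roots of unity, \<kappa> is the quotient of the
classes and \<mu> the quotient of two elements of the parts.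
\<close>

lemma ratio_across_classes:
  assumes \<kappa>: "\<kappa> ^ 5 = 1" "\<kappa> \<noteq> 1"
    and \<mu>: "\<mu> = 1 \<and> n \<ge> 5 \<or> \<mu> \<in> {\<eta>, 1 - \<eta>} \<and> n \<ge> 6 \<or> \<mu> \<in> {\<eta> - 1, - \<eta>} \<and> n \<ge> 7"
  shows "ratio_in_weight (\<kappa> * \<mu>) n"
proof -
  have "\<mu> ^ 3 = 1 \<or> \<mu> ^ 3 = -1" using \<mu> eta_powers by auto
  moreover have "\<mu> ^ 6 = \<mu> ^ 3 * \<mu> ^ 3" by (simp flip: power_add)
  ultimately have \<mu>6: "\<mu> ^ 6 = 1" by (elim disjE) (simp_all only: mult_1 minus_mult_minus)
  have "\<kappa> ^ 15 = 1" "\<kappa> ^ 10 = 1" "\<kappa> ^ 6 = \<kappa>"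
    using root_of_unity_power_mod [OF \<kappa>(1), of 15] root_of_unity_power_mod [OF \<kappa>(1), of 10]
      root_of_unity_power_mod [OF \<kappa>(1), of 6] by simp_all
  moreover have "\<mu> ^ 15 = \<mu> ^ 3" "\<mu> ^ 10 = \<mu> ^ 4"
    using root_of_unity_power_mod [OF \<mu>6, of 15] root_of_unity_power_mod [OF \<mu>6, of 10] by simp_all
  moreover have "\<mu> ^ 4 = \<mu> ^ 3 * \<mu>" by (simp flip: power_Suc2)
  ultimately have "(\<kappa> * \<mu>) ^ 15 = \<mu> ^ 3" "(\<kappa> * \<mu>) ^ 10 = \<mu> ^ 3 * \<mu>" "(\<kappa> * \<mu>) ^ 6 = \<kappa>"
    using \<mu>6 by (simp_all only: power_mult_distrib mult_1 mult_1_right)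
  note powers = this
  from \<mu> consider "\<mu> = 1" "n \<ge> 5" | "\<mu> \<in> {\<eta>, 1 - \<eta>}" "n \<ge> 6" | "\<mu> \<in> {\<eta> - 1, - \<eta>}" "n \<ge> 7"
    by blast
  then show ?thesis
  proof cases
    case 1
    then show ?thesis using powers \<kappa>(2) by (simp add: ratio_in_weight_def)
  next
    case 2
    then have "\<mu> ^ 3 = -1" "\<mu> \<noteq> -1" using eta_powers eta_neq by auto
    then have "(\<kappa> * \<mu>) ^ 15 \<noteq> 1" "(\<kappa> * \<mu>) ^ 10 \<noteq> 1"
      unfolding powers by (simp_all add: minus_equation_iff [of \<mu>])
    then show ?thesis using powers(3) \<kappa>(2) 2 by (simp add: ratio_in_weight_def)
  next
    case 3
    then have "\<mu> ^ 3 = 1" "\<mu> \<noteq> 1" using eta_powers eta_neq by auto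
    then show ?thesis using powers \<kappa>(2) 3 by (simp add: ratio_in_weight_def)
  qed
qed

text \<open>
Split R along the prime 5. If the parts vanish, R is a rotated antipodal pair or triangle. If not,
\<open>common_sixth_root\<close> and minimality say that R arises from a regular pentagon
with vertices ce, c^5 = 1, by replacing some vertices, each by the two numbers obtained from it
by rotation through 60 degrees in either direction, which sum to it. The weight is 5 plus the number of
replaced vertices, and a quotient that involves one of these numbers requires its vertex to be
replaced.
\<close>

lemma minimal_ratio_in_weight:
  assumes R: "\<And>z. z \<in># R \<Longrightarrow> z ^ 30 = 1" and min: "minimal_vanishing R"
    and ab: "{#a, b#} \<subseteq># R"
  shows "ratio_in_weight (b / a) (size R)"
proof -
  interpret prime_split 5 6 R
    using R coprime_Suc_right_nat [of 5] by unfold_locales simp_all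
  have aR: "a \<in># R" and bR: "b \<in># R" using mset_subset_eqD [OF ab] by auto
  have in_part: "c \<noteq> 0 \<Longrightarrow> z \<in># R \<Longrightarrow> (z / c) ^ 6 = 1 \<Longrightarrow> z / c \<in># part 6 R c" for z c
    by (auto simp: part_def)
  obtain c where c: "c \<in> roots_of_one 5" "(a / c) ^ 6 = 1"
    using unique_class [OF roots [OF aR]] by blast
  obtain d where d: "d \<in> roots_of_one 5" "(b / d) ^ 6 = 1"
    using unique_class [OF roots [OF bR]] by blast
  have c0: "c \<noteq> 0" and d0: "d \<noteq> 0" using class_nonzero c d by auto
  have a0: "a \<noteq> 0" using c by auto
  have same: "{#a / c, b / c#} \<subseteq># part 6 R c" if "(b / c) ^ 6 = 1"
  proof -
    have "filter_mset (\<lambda>m. m ^ 6 = 1) (image_mset (\<lambda>z. z / c) {#a, b#}) \<subseteq># part 6 R c"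
      unfolding part_def by (intro multiset_filter_mono image_mset_subseteq_mono ab)
    then show ?thesis using that c by simp
  qed
  have part6: "z ^ 6 = 1" if "z \<in># part 6 R x" for x z
    using that by (rule part_roots)
  have val: "sum_mset (part 6 R x) = sum_mset (part 6 R y)" if "x \<in> roots_of_one 5" "y \<in> roots_of_one 5" for x y
    using part_value_const [OF minimal_vanishing_vanishing [OF min] that] .
  show ?thesis
  proof (cases "sum_mset (part 6 R c) = 0")
    case True
    have ac: "a / c \<in># part 6 R c" using in_part c0 aR c(2) .
    then have Rc: "R = image_mset ((*) c) (part 6 R c)"
      using True by (intro vanishing_subpart [OF min c(1)]) (auto simp: vanishing_def)
    then have bc: "(b / c) ^ 6 = 1"
      using bR c0 by (metis (no_types, lifting) image_iff multiset.set_map nonzero_mult_div_cancel_left part_roots)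
    have size: "size R = size (part 6 R c)" by (metis Rc size_image_mset)
    have "image_mset ((*) (1 / c)) R = part 6 R c"
      using c0 by (subst Rc) (simp add: image_mset.compositionality comp_def)
    then have "minimal_vanishing (part 6 R c)"
      using minimal_vanishing_image_mult [OF _ min, of "1 / c"] c0 by simp
    then have "b / c = - (a / c) \<and> size R = 2 \<or> (b / c) / (a / c) \<in> {\<eta> - 1, - \<eta>} \<and> size R = 3"
      unfolding size by (intro minimal_sixth_roots same [OF bc]) (rule part6)
    then consider "b / c = - (a / c)" "size R = 2" | "(b / c) / (a / c) \<in> {\<eta> - 1, - \<eta>}" "size R = 3"
      by blast
    then show ?thesis
    proof cases
      case 1
      then have "b / a = - 1" using c0 a0 by (simp add: field_simps)
      with 1 show ?thesis by (simp add: ratio_in_weight_def)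
    next
      case 2
      then show ?thesis using ratio_order_three [of "b / a" "size R"] c0 by simp
    qed
  next
    case False
    then obtain e where e: "e ^ 6 = 1" and e_sub: "\<And>g. \<forall>z\<in>#g. z ^ 6 = 1 \<Longrightarrow>
        sum_mset g = sum_mset (part 6 R c) \<Longrightarrow> {#e#} \<subseteq># g \<or> {#e * \<eta>, e * (1 - \<eta>)#} \<subseteq># g"
      using common_sixth_root [of "part 6 R c"] part6 False by blast
    have e0: "e \<noteq> 0" using e by auto
    define g where "g x = (if {#e#} \<subseteq># part 6 R x then {#e#} else {#e * \<eta>, e * (1 - \<eta>)#})" for x
    have "g x \<subseteq># part 6 R x" if "x \<in> roots_of_one 5" for x
      using e_sub [of "part 6 R x"] part6 val [OF that c(1)] by (auto simp: g_def)
    moreover have "sum_mset (g x) = e" for x by (simp add: g_def algebra_simps)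
    ultimately have "\<forall>x\<in>roots_of_one 5. g x = part 6 R x"
      using equal_subvalues [OF min, of g e] c(1) by (auto simp: g_def split: if_splits)
    then have part: "part 6 R x = {#e#} \<or> part 6 R x = {#e * \<eta>, e * (1 - \<eta>)#}" if "x \<in> roots_of_one 5" for x
      using that by (metis g_def)
    then have ge1: "size (part 6 R x) \<ge> 1" if "x \<in> roots_of_one 5" for x using that by fastforce
    show ?thesis
    proof (cases "c = d")
      case True
      then have sub: "{#a / c, b / c#} \<subseteq># part 6 R c" using same d by simp
      with part [OF c(1)] have pc: "part 6 R c = {#e * \<eta>, e * (1 - \<eta>)#}"
        by (auto dest: size_mset_mono)
      then have "{#a / c, b / c#} = {#e * \<eta>, e * (1 - \<eta>)#}"
        using sub by (metis mset_subset_size less_irrefl size_add_mset subset_mset.le_imp_less_or_eq)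
      then have "a / c = e * \<eta> \<and> b / c = e * (1 - \<eta>) \<or> a / c = e * (1 - \<eta>) \<and> b / c = e * \<eta>"
        by (auto simp: add_eq_conv_ex)
      then have "(b / c) / (a / c) = (1 - \<eta>) / \<eta> \<or> (b / c) / (a / c) = \<eta> / (1 - \<eta>)"
        by (elim disjE conjE) (simp_all only: mult_divide_mult_cancel_left [OF e0] simp_thms)
      moreover have "(1 - \<eta>) / \<eta> = - \<eta>" "\<eta> / (1 - \<eta>) = \<eta> - 1"
        using eta_sq eta_neq by (auto simp: field_simps)
      ultimately have ratio: "b / a \<in> {\<eta> - 1, - \<eta>}" using c0 by auto
      have "size R = size (part 6 R c) + (\<Sum>x\<in>roots_of_one 5 - {c}. size (part 6 R x))"
        using size_parts sum.remove [OF finite_classes c(1)] by metis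
      moreover have "(\<Sum>x\<in>roots_of_one 5 - {c}. size (part 6 R x)) \<ge> (\<Sum>x\<in>roots_of_one 5 - {c}. 1)"
        by (rule sum_mono) (use ge1 in auto)
      ultimately have "size R \<ge> 6" using pc c(1) finite_classes card_classes by simp
      then show ?thesis using ratio_order_three [OF ratio] by simp
    next
      case False
      have "size R = size (part 6 R c) + (size (part 6 R d) + (\<Sum>x\<in>roots_of_one 5 - {c} - {d}. size (part 6 R x)))"
        using size_parts sum.remove [OF finite_classes c(1)] d(1) False finite_classes
          sum.remove [of "roots_of_one 5 - {c}" d "\<lambda>x. size (part 6 R x)"] by (metis DiffI finite_Diff singletonD)
      moreover have "(\<Sum>x\<in>roots_of_one 5 - {c} - {d}. size (part 6 R x)) \<ge> (\<Sum>x\<in>roots_of_one 5 - {c} - {d}. 1)"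
        by (rule sum_mono) (use ge1 in auto)
      moreover have "card (roots_of_one 5 - {c} - {d}) = 3"
        using c(1) d(1) False finite_classes card_classes by simp
      ultimately have size: "size R \<ge> size (part 6 R c) + size (part 6 R d) + 3" by simp
      have ac: "a / c \<in># part 6 R c" and bd: "b / d \<in># part 6 R d"
        using in_part c0 d0 aR bR c(2) d(2) by auto
      define \<mu> where "\<mu> = (b / d) / (a / c)"
      have ba: "b / a = d / c * \<mu>" using c0 d0 a0 by (simp add: \<mu>_def)
      have quot: "(1 - \<eta>) / \<eta> = - \<eta>" "\<eta> / (1 - \<eta>) = \<eta> - 1" "1 / \<eta> = 1 - \<eta>" "1 / (1 - \<eta>) = \<eta>"
        using eta_sq eta_neq by (auto simp: field_simps)
      have coord: "\<exists>i. y = e * i \<and> (i = 1 \<and> size (part 6 R x) = 1 \<or> i \<in> {\<eta>, 1 - \<eta>} \<and> size (part 6 R x) = 2)"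
        if "x \<in> roots_of_one 5" "y \<in># part 6 R x" for x y
        using part [OF that(1)] that(2) by (elim disjE) auto
      obtain i where i: "a / c = e * i"
          "i = 1 \<and> size (part 6 R c) = 1 \<or> i \<in> {\<eta>, 1 - \<eta>} \<and> size (part 6 R c) = 2"
        using coord [OF c(1) ac] by blast
      obtain j where j: "b / d = e * j"
          "j = 1 \<and> size (part 6 R d) = 1 \<or> j \<in> {\<eta>, 1 - \<eta>} \<and> size (part 6 R d) = 2"
        using coord [OF d(1) bd] by blast
      have "\<mu> = j / i" unfolding \<mu>_def i(1) j(1) by (rule mult_divide_mult_cancel_left [OF e0])
      then have "\<mu> = 1 \<and> size R \<ge> 5 \<or> \<mu> \<in> {\<eta>, 1 - \<eta>} \<and> size R \<ge> 6 \<or> \<mu> \<in> {\<eta> - 1, - \<eta>} \<and> size R \<ge> 7"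
        using i(2) j(2) size eta_neq
        by (elim disjE conjE insertE emptyE) (simp_all add: quot)
      moreover have "(d / c) ^ 5 = 1" "d / c \<noteq> 1" using c d False c0 by (auto simp: power_divide)
      ultimately show ?thesis unfolding ba by (intro ratio_across_classes)
    qed
  qed
qed

section \<open>Repeated roots in sums of weight at most 21\<close>

lemma (in prime_split) size_lower_bound:
  assumes K: "K \<subseteq> roots_of_one p" and k: "\<And>c. c \<in> roots_of_one p \<Longrightarrow> k \<le> size (part M h c)"
  shows "(\<Sum>c\<in>K. size (part M h c)) + k * (p - card K) \<le> size h"
proof -
  have "card (roots_of_one p - K) = p - card K"
    using K finite_classes card_classes by (simp add: card_Diff_subset finite_subset)
  then have "k * (p - card K) = (\<Sum>c\<in>roots_of_one p - K. k)" by simp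
  also have "\<dots> \<le> (\<Sum>c\<in>roots_of_one p - K. size (part M h c))"
    by (rule sum_mono) (use k in auto)
  finally show ?thesis
    using sum.subset_diff [OF K finite_classes, of "\<lambda>c. size (part M h c)"] size_parts by linarith
qed

lemma (in prime_split) part_of_member:
  assumes "z \<in># h"
  shows "\<exists>c\<in>roots_of_one p. \<exists>m. count (part M h c) m = count h z"
proof -
  obtain c where c: "c \<in> roots_of_one p" "(z / c) ^ M = 1"
    using unique_class [OF roots [OF assms]] by blast
  then have "count (part M h c) (z / c) = count h z"
    using count_part [OF class_nonzero [OF c(1)]] class_nonzero [OF c(1)] by simp
  with c(1) show ?thesis by blast
qed

lemma reduced_part_zero_sum_free:
  assumes red: "reduced N h" and min: "minimal_vanishing h" and ne: "h \<noteq> {#}"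
    and p: "prime p" and N: "N = p * M" and c: "c \<in> roots_of_one p"
  shows "zero_sum_free (part M h c)"
  unfolding zero_sum_free_def
proof (intro allI impI, rule ccontr)
  interpret prime_split p M h using reduced_prime_split [OF red min ne p N] .
  fix g assume g: "g \<subseteq># part M h c \<and> vanishing g" "g \<noteq> {#}"
  then have "h = image_mset ((*) c) g" by (intro vanishing_subpart [OF min c]) auto
  then have "size h = size g" by (metis size_image_mset)
  moreover have "size (part M h c) \<le> size h"
    using size_lower_bound [of "{c}" 0] c by simp
  ultimately have "g = part M h c"
    using g by (metis leD mset_subset_size subset_mset.le_imp_less_or_eq)
  then show False
    using reduced_part_value_nonzero [OF red min ne p N c] g by (simp add: vanishing_def)
qed

lemma subseteq_add_mset_cases:
  assumes "g \<subseteq># add_mset a f"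
  obtains "g \<subseteq># f" | g' where "g = add_mset a g'" "g' \<subseteq># f"
proof (cases "a \<in># g")
  case True
  then obtain g' where "g = add_mset a g'" by (metis multi_member_split)
  with assms that(2) show ?thesis by simp
next
  case False
  with assms have "g \<subseteq># f"
    by (metis diff_single_trivial subset_eq_diff_conv add_mset_add_single)
  with that(1) show ?thesis .
qed

lemma zero_sum_free_subset: "zero_sum_free f \<Longrightarrow> g \<subseteq># f \<Longrightarrow> zero_sum_free g"
  unfolding zero_sum_free_def using subset_mset.order_trans by blast

lemma sum_mset_complement: "g \<subseteq># f \<Longrightarrow> sum_mset (f - g) = sum_mset f - sum_mset g"
  for f :: "complex multiset"
  by (metis add_diff_cancel_left' subset_mset.add_diff_inverse sum_mset.union)

lemma zero_sum_free_same_sum: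
  assumes "zero_sum_free f" "g \<subseteq># f" "sum_mset g = sum_mset f"
  shows "g = f"
proof -
  have "vanishing (f - g)" using assms by (simp add: vanishing_def sum_mset_complement)
  then have "f - g = {#}" using assms(1) by (auto simp: zero_sum_free_def)
  with assms(2) show ?thesis by (metis Diff_eq_empty_iff_mset subset_mset.antisym)
qed

lemma minimal_vanishing_add_negated_sum:
  assumes "zero_sum_free f"
  shows "minimal_vanishing (add_mset (- sum_mset f) f)"
  unfolding minimal_vanishing_def
proof (intro conjI allI impI notI)
  show "vanishing (add_mset (- sum_mset f) f)" by (simp add: vanishing_def)
  fix g assume g: "g \<subset># add_mset (- sum_mset f) f \<and> g \<noteq> {#}" and van: "vanishing g"
  have "g \<subseteq># add_mset (- sum_mset f) f" using g by auto
  then show False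
  proof (cases rule: subseteq_add_mset_cases)
    case 1
    with assms g van show False by (auto simp: zero_sum_free_def)
  next
    case (2 g')
    then have "g' = f" using van by (intro zero_sum_free_same_sum assms) (auto simp: vanishing_def)
    with 2 g show False by simp
  qed
qed

text \<open>
A vanishing subsum can contain neither none nor both of -x and -y: either it or its complement
would lie in f.
\<close>

lemma not_minimal_splits:
  assumes free: "zero_sum_free f" and sum: "sum_mset f = x + y"
    and "\<not> minimal_vanishing (add_mset (- x) (add_mset (- y) f))"
  shows "\<exists>X. X \<subseteq># f \<and> sum_mset X = x"
proof -
  have "vanishing (add_mset (- x) (add_mset (- y) f))" using sum by (simp add: vanishing_def)
  with assms(3) obtain g where g: "g \<subset># add_mset (- x) (add_mset (- y) f)" "g \<noteq> {#}" "vanishing g"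
    by (auto simp: minimal_vanishing_def)
  from g(1) have "g \<subseteq># add_mset (- x) (add_mset (- y) f)" by auto
  then show ?thesis
  proof (cases rule: subseteq_add_mset_cases)
    case 1
    then show ?thesis
    proof (cases rule: subseteq_add_mset_cases)
      case 1
      with free g(2,3) show ?thesis by (auto simp: zero_sum_free_def)
    next
      case (2 g')
      then have "sum_mset (f - g') = x" using g(3) sum by (simp add: sum_mset_complement vanishing_def)
      then show ?thesis by (intro exI [of _ "f - g'"]) auto
    qed
  next
    case (2 g')
    from 2(2) show ?thesis
    proof (cases rule: subseteq_add_mset_cases)
      case 1
      then show ?thesis using 2(1) g(3) by (intro exI [of _ g']) (auto simp: vanishing_def)
    next
      case (2 g'')
      then have "g'' = f"
        using g(3) \<open>g = add_mset (- x) g'\<close> sum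
        by (intro zero_sum_free_same_sum free) (auto simp: vanishing_def algebra_simps add_eq_0_iff)
      with 2 \<open>g = add_mset (- x) g'\<close> g(1) show ?thesis by simp
    qed
  qed
qed

text \<open>
Equality in the triangle inequality.
\<close>

lemma three_equal_unit_vectors:
  fixes m :: complex
  assumes "size f = 3" and unit: "\<And>z. z \<in># f \<Longrightarrow> norm z = 1" and m: "norm m = 1"
    and sum: "sum_mset f = 3 * m"
  shows "m \<in># f"
proof -
  obtain a f' where f': "f = add_mset a f'"
    using size_eq_Suc_imp_eq_union [of f 2] assms(1) by auto
  obtain b f'' where f'': "f' = add_mset b f''"
    using size_eq_Suc_imp_eq_union [of f' 1] assms(1) f' by auto
  obtain c where "f'' = {#c#}"
    using size_1_singleton_mset [of f''] assms(1) f' f'' by auto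
  then have f: "f = {#a, b, c#}" using f' f'' by simp
  have m0: "m \<noteq> 0" using m by auto
  have "a / m + b / m + c / m = 3"
    using sum m0 by (simp add: f field_simps)
  then have "Re (a / m + b / m + c / m) = Re 3" by (rule arg_cong)
  then have "Re (a / m) + Re (b / m) + Re (c / m) = 3"
    by (simp only: plus_complex.sel complex_Re_numeral)
  moreover have norms: "norm (a / m) = 1" "norm (b / m) = 1" "norm (c / m) = 1"
    using unit m by (auto simp: f norm_divide)
  then have "Re (a / m) \<le> 1" "Re (b / m) \<le> 1" "Re (c / m) \<le> 1"
    by (metis complex_Re_le_cmod)+
  ultimately have re: "Re (a / m) = 1" by linarith
  then have "Im (a / m) = 0" using norms(1) by (simp add: cmod_def)
  with re have "a / m = 1" by (simp add: complex_eq_iff)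
  then show ?thesis using m0 by (simp add: f)
qed

lemma dvd_210:
  fixes N :: nat
  assumes "N > 0" "\<And>p. prime p \<Longrightarrow> p dvd N \<Longrightarrow> p \<in> {2, 3, 5, 7}"
    and sq: "\<And>p M. prime p \<Longrightarrow> N = p * M \<Longrightarrow> \<not> p dvd M"
  shows "N dvd 210"
proof -
  have "multiplicity p N = 1" if "p \<in> prime_factors N" for p
  proof -
    have p: "prime p" "p dvd N" using that by auto
    then obtain M where M: "N = p * M" by auto
    with sq [OF p(1) M] p(1) assms(1) show ?thesis
      by (simp add: prime_elem_multiplicity_mult_distrib not_dvd_imp_multiplicity_0)
  qed
  then have "N = (\<Prod>p\<in>prime_factors N. p)"
    using prime_factorization_nat [of N] assms(1) by simp
  also have "\<dots> dvd (\<Prod>p\<in>{2, 3, 5, 7}. p)"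
    by (rule prod_dvd_prod_subset) (use assms(2) in auto)
  finally show ?thesis by simp
qed

lemma cube_roots_sum:
  fixes u w :: complex
  assumes "u ^ 3 = 1" "w ^ 3 = 1" "u \<noteq> 1" "w \<noteq> 1" "u \<noteq> w"
  shows "u + w = -1"
proof -
  have "(z - 1) * (z\<^sup>2 + z + 1) = z ^ 3 - 1" for z :: complex
    by (simp add: algebra_simps power2_eq_square power3_eq_cube)
  then have "u\<^sup>2 + u + 1 = 0" "w\<^sup>2 + w + 1 = 0"
    using assms(1-4) by (metis diff_self mult_eq_0_iff right_minus_eq)+
  moreover have "(u - w) * (u + w + 1) = (u\<^sup>2 + u + 1) - (w\<^sup>2 + w + 1)"
    by (simp add: algebra_simps power2_eq_square)
  ultimately have "(u - w) * (u + w + 1) = 0" by simp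
  then have "u + w + 1 = 0" using assms(5) by auto
  then show ?thesis by (simp add: eq_neg_iff_add_eq_0)
qed

lemma root_of_unity_power_dvd: "z ^ k = 1 \<Longrightarrow> k dvd n \<Longrightarrow> z ^ n = 1" for z :: "'a :: monoid_mult"
  by (elim dvdE) (simp add: power_mult)

text \<open>
The induction step of \<open>repeated_root\<close>, for a sum that has been rotated into reduced form.
\<close>

lemma reduced_repeated_root:
  assumes IH: "\<And>g b. size g < size h \<Longrightarrow> \<forall>z\<in>#g. root_of_unity z \<Longrightarrow> minimal_vanishing g \<Longrightarrow> count g b \<le> 1"
    and red: "reduced N h" and min: "minimal_vanishing h" and size: "size h \<le> 21"
    and a: "count h a \<ge> 2"
  shows "size h = 21 \<and> count h a = 2"
proof -
  have "count h a > 0" using a by linarith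
  then have ne: "h \<noteq> {#}" and ah: "a \<in># h" by auto
  have N0: "N > 0" using red by (simp add: reduced_def)
  have root_pm: "root_of_unity z" "root_of_unity (- z)" if "z ^ K = 1" "K > 0" for z K
  proof -
    have "(- z) ^ (2 * K) = z ^ (2 * K)" by (rule power_minus_even) simp
    also have "\<dots> = 1" using that(1) by (simp only: power_even_eq power_one)
    finally have "(- z) ^ (2 * K) = 1" .
    then show "root_of_unity z" "root_of_unity (- z)"
      using that unfolding root_of_unity_def by (blast, metis mult_pos_pos pos2)
  qed
  note van = minimal_vanishing_vanishing [OF min]
  have ge2: "2 \<le> size (part M h d)"
    if pp: "prime p" "p \<ge> 3" and N: "N = p * M" and d: "d \<in> roots_of_one p" for p M d
  proof (rule ccontr)
    interpret prime_split p M h using reduced_prime_split [OF red min ne pp(1) N] .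
    note nonzero = reduced_part_value_nonzero [OF red min ne pp(1) N]
    have ge1: "1 \<le> size (part M h c)" if "c \<in> roots_of_one p" for c
      using nonzero [OF that] by (cases "part M h c") auto
    assume "\<not> 2 \<le> size (part M h d)"
    then have "size (part M h d) = 1" using ge1 [OF d] by simp
    then obtain x where x: "part M h d = {#x#}" using size_1_singleton_mset by blast
    obtain c m where c: "c \<in> roots_of_one p" and m: "count (part M h c) m = count h a"
      using part_of_member [OF ah] by blast
    have xc: "x = sum_mset (part M h c)" using part_value_const [OF van c d] x by simp
    define g where "g = add_mset (- x) (part M h c)"
    have "minimal_vanishing g"
      unfolding g_def xc
      by (intro minimal_vanishing_add_negated_sum reduced_part_zero_sum_free [OF red min ne pp(1) N c])
    moreover have "size g < size h"
      using size_lower_bound [of "{c}" 1] c ge1 pp(2) by (simp add: g_def)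
    moreover have "\<forall>z\<in>#g. root_of_unity z"
      using root_pm(2) [OF part_roots [of x M h d] M] root_pm(1) [OF part_roots M] x by (auto simp: g_def)
    ultimately have "count g m \<le> 1" using IH by blast
    then show False using m a by (simp add: g_def split: if_splits)
  qed
  have primes: "p \<in> {2, 3, 5, 7}" if pp: "prime p" "p dvd N" for p
  proof (cases "p \<ge> 3")
    case True
    obtain M where N: "N = p * M" using pp(2) by auto
    interpret prime_split p M h using reduced_prime_split [OF red min ne pp(1) N] .
    have "2 * p \<le> size h" using size_lower_bound [of "{}" 2] ge2 [OF pp(1) True N] by simp
    then have "p \<le> 10" using size by simp
    then have "p \<in> {2, 3, 4, 5, 6, 7, 8, 9, 10}" using True by auto
    moreover have "\<not> prime (4 :: nat)" "\<not> prime (6 :: nat)" "\<not> prime (8 :: nat)" "\<not> prime (9 :: nat)" "\<not> prime (10 :: nat)"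
      by simp_all
    ultimately show ?thesis using pp(1) by auto
  next
    case False
    then show ?thesis using prime_ge_2_nat [OF pp(1)] by simp
  qed
  have N210: "N dvd 210"
    using dvd_210 [OF N0 primes reduced_prime_not_dvd [OF red min ne]] by blast
  have "7 dvd N"
  proof (rule ccontr)
    assume "\<not> 7 dvd N"
    then have "coprime 7 N" by (intro prime_imp_coprime) simp_all
    then have "coprime N 7" by (rule coprime_commute [THEN iffD1])
    then have "N dvd 30" using N210 coprime_dvd_mult_left_iff [of N 7 30] by simp
    then have h30: "z ^ 30 = 1" if "z \<in># h" for z
      using red that by (auto simp: reduced_def intro: root_of_unity_power_dvd)
    have "{#a, a#} \<subseteq># h"
      using a by (auto simp: subseteq_mset_def)
    then have "ratio_in_weight (a / a) (size h)" by (intro minimal_ratio_in_weight min h30)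
    moreover have "a \<noteq> 0" using h30 [OF ah] by auto
    ultimately show False by (simp add: ratio_in_weight_def)
  qed
  then obtain M where N: "N = 7 * M" by auto
  have M30: "M dvd 30" using N210 N by simp
  have p7: "prime (7 :: nat)" by simp
  interpret prime_split 7 M h using reduced_prime_split [OF red min ne p7 N] .
  note free = reduced_part_zero_sum_free [OF red min ne p7 N]
  have ge2: "2 \<le> size (part M h d)" if "d \<in> roots_of_one 7" for d
    using ge2 [OF p7 _ N that] by simp
  \<comment> \<open>The part that contains the repeated root, and its image there.\<close>
  obtain c m where c: "c \<in> roots_of_one 7" and m: "count (part M h c) m = count h a"
    using part_of_member [OF ah] by blast
  have mc: "m \<in># part M h c" using m a by (metis count_greater_zero_iff less_le_trans pos2)
  show ?thesis
  proof (cases "\<forall>d\<in>roots_of_one 7. 3 \<le> size (part M h d)")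
    case True
    then have "3 * 7 \<le> size h" using size_lower_bound [of "{}" 3] by simp
    with size have h21: "size h = 21" by simp
    have three: "size (part M h d) = 3" if "d \<in> roots_of_one 7" for d
      using size_lower_bound [of "{d}" 3] True that h21 by fastforce
    have "count h a \<le> 2"
    proof (rule ccontr)
      assume "\<not> count h a \<le> 2"
      then have "replicate_mset 3 m \<subseteq># part M h c" using m by (simp add: count_le_replicate_mset_subset_eq [symmetric])
      then have mmm: "part M h c = replicate_mset 3 m"
        using three [OF c] by (metis less_irrefl mset_subset_size size_replicate_mset subset_mset.le_imp_less_or_eq)
      have unit: "norm z = 1" if "z \<in># part M h d" for z d
        using power_eq_1_iff [OF part_roots [OF that]] M by simp
      have "m \<in># part M h d" if d: "d \<in> roots_of_one 7" for d
      proof (rule three_equal_unit_vectors)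
        show "sum_mset (part M h d) = 3 * m"
          using part_value_const [OF van d c] by (simp add: mmm)
      qed (use three [OF d] unit mc in auto)
      then have "part M h c = {#m#}"
        using equal_subvalues [OF min, of "\<lambda>_. {#m#}" m] c by auto
      then show False using three [OF c] by simp
    qed
    with a h21 show ?thesis by simp
  next
    case False
    then obtain d where d1: "d \<in> roots_of_one 7" and "\<not> 3 \<le> size (part M h d)" by blast
    then have "size (part M h d) = 2" using ge2 [OF d1] by linarith
    with d1 have d: "d \<in> roots_of_one 7" "size (part M h d) = 2" by auto
    obtain x f' where f': "part M h d = add_mset x f'"
      using size_eq_Suc_imp_eq_union [of "part M h d" 1] d(2) by auto
    then obtain y where "f' = {#y#}"
      using size_1_singleton_mset [of f'] d(2) by auto
    with f' have xy: "part M h d = {#x, y#}" by simp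
    have val: "sum_mset (part M h b) = x + y" if "b \<in> roots_of_one 7" for b
      using part_value_const [OF van that d(1)] xy by simp
    have root30: "z ^ 30 = 1" if "z \<in># part M h b" for z b
      using part_roots [OF that] M30 by (rule root_of_unity_power_dvd)
    have x30: "x ^ 30 = 1" and y30: "y ^ 30 = 1" using root30 [of _ d] xy by auto
    then have x0: "x \<noteq> 0" and y0: "y \<noteq> 0" by auto
    \<comment> \<open>Otherwise x would be a common subvalue of all parts.\<close>
    have "\<exists>b\<in>roots_of_one 7. \<not> (\<exists>X. X \<subseteq># part M h b \<and> sum_mset X = x)"
    proof (rule ccontr)
      assume "\<not> ?thesis"
      then obtain X where X: "\<And>b. b \<in> roots_of_one 7 \<Longrightarrow> X b \<subseteq># part M h b \<and> sum_mset (X b) = x"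
        by metis
      then have "X d = {#} \<or> X d = part M h d" using equal_subvalues [OF min, of X x] d(1) by blast
      then have "sum_mset (X d) = 0 \<or> sum_mset (X d) = x + y" using val [OF d(1)] by auto
      then show False using X [OF d(1)] x0 y0 by simp
    qed
    then obtain b where b: "b \<in> roots_of_one 7"
        and unsplit: "\<not> (\<exists>X. X \<subseteq># part M h b \<and> sum_mset X = x)"
      by blast
    define R where "R = add_mset (- x) (add_mset (- y) (part M h b))"
    have minR: "minimal_vanishing R"
      using not_minimal_splits [OF free [OF b] val [OF b]] unsplit unfolding R_def by blast
    have root30_pm: "z ^ 30 = 1" if "z \<in># add_mset (- x) (add_mset (- y) (part M h e))" for z e
      using that x30 y30 root30 [of z e] by auto
    have count_small: "count g n \<le> 1"
      if "minimal_vanishing g" "g \<subseteq># add_mset (- x) (add_mset (- y) (part M h c))" for g n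
    proof (rule IH [OF _ _ that(1)])
      have "size g \<le> size (part M h c) + 2" using size_mset_mono [OF that(2)] by simp
      also have "\<dots> < size h" using size_lower_bound [of "{c}" 2] c ge2 by simp
      finally show "size g < size h" .
      show "\<forall>z\<in>#g. root_of_unity z"
      proof
        fix z assume "z \<in># g"
        then have "z \<in># add_mset (- x) (add_mset (- y) (part M h c))" using that(2) by (rule mset_subset_eqD [rotated])
        then have "z ^ 30 = 1" by (rule root30_pm)
        then show "root_of_unity z" by (rule root_pm(1)) simp
      qed
    qed
    have "\<not> minimal_vanishing (add_mset (- x) (add_mset (- y) (part M h c)))"
    proof
      assume "minimal_vanishing (add_mset (- x) (add_mset (- y) (part M h c)))"
      then have "count (add_mset (- x) (add_mset (- y) (part M h c))) m \<le> 1" by (rule count_small) simp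
      then show False using m a by (simp split: if_splits)
    qed
    then obtain X where X: "X \<subseteq># part M h c" "sum_mset X = x"
      using not_minimal_splits [OF free [OF c] val [OF c]] by blast
    define Y where "Y = part M h c - X"
    have Y: "Y \<subseteq># part M h c" "sum_mset Y = y"
      using X val [OF c] by (auto simp: Y_def sum_mset_complement)
    have XY: "part M h c = X + Y" using X by (simp add: Y_def)
    have minX: "minimal_vanishing (add_mset (- x) X)" and minY: "minimal_vanishing (add_mset (- y) Y)"
      using minimal_vanishing_add_negated_sum zero_sum_free_subset [OF free [OF c]] X Y by metis+
    have subX: "add_mset (- x) X \<subseteq># add_mset (- x) (add_mset (- y) (part M h c))"
      and subY: "add_mset (- y) Y \<subseteq># add_mset (- x) (add_mset (- y) (part M h c))"
      using X(1) Y(1) by (auto intro: subset_mset.order_trans)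
    have "count X m \<le> 1" "count Y m \<le> 1"
      using count_small [OF minX subX, of m] count_small [OF minY subY, of m] by (simp_all split: if_splits)
    moreover have "count h a = count X m + count Y m" using m XY by simp
    ultimately have counts: "count X m = 1" "count Y m = 1" "count h a = 2" using a by simp_all
    have mXY: "m \<in># X" "m \<in># Y" using counts by (metis count_eq_zero_iff zero_neq_one)+
    have m0: "m \<noteq> 0" using root30 [OF mc] by auto
    define r where "r = m / (- x)"
    define t where "t = (- x) / (- y)"
    have rt: "r * t = m / (- y)" using x0 y0 by (simp add: r_def t_def)
    have "ratio_in_weight r (size (add_mset (- x) X))"
      unfolding r_def
      by (rule minimal_ratio_in_weight [OF root30_pm [OF mset_subset_eqD [OF subX]] minX])
        (simp_all add: mXY)
    moreover have "ratio_in_weight (r * t) (size (add_mset (- y) Y))"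
      unfolding rt
      by (rule minimal_ratio_in_weight [OF root30_pm [OF mset_subset_eqD [OF subY]] minY])
        (simp_all add: mXY)
    moreover have "ratio_in_weight t (size R)"
      unfolding t_def
    proof (rule minimal_ratio_in_weight [OF _ minR])
      show "z ^ 30 = 1" if "z \<in># R" for z
        using that unfolding R_def by (rule root30_pm)
      show "{#- y, - x#} \<subseteq># R" by (simp add: R_def add_mset_commute)
    qed
    moreover have "r ^ 30 = 1" "t ^ 30 = 1"
      using x30 y30 root30 [OF mc] by (simp_all add: r_def t_def power_divide)
    ultimately consider "15 \<le> size (add_mset (- x) X) + size R + size (add_mset (- y) Y)"
      | "\<forall>z\<in>{r, t, r * t}. z ^ 15 = 1 \<and> z ^ 10 \<noteq> 1 \<and> z ^ 6 = 1"
      using ratio_triangle [of r t] by blast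
    then show ?thesis
    proof cases
      case 1
      have "b \<noteq> c" using X unsplit by blast
      then have "size (part M h b) + size (part M h c) + 2 * 5 \<le> size h"
        using size_lower_bound [of "{b, c}" 2] b c ge2 by simp
      moreover have "size (part M h b) + size (part M h c) \<ge> 11"
        using 1 by (simp add: R_def XY)
      ultimately show ?thesis using size counts by simp
    next
      case 2
      \<comment> \<open>Three quotients of order 3 give x + y = m, so that the rest of the part vanishes.\<close>
      have cube: "z ^ 3 = 1 \<and> z \<noteq> 1" if "z \<in> {r, t, r * t}" for z
      proof -
        have z: "z ^ 15 = 1" "z ^ 10 \<noteq> 1" "z ^ 6 = 1" using 2 that by blast+
        have "z ^ 6 * z ^ 6 * z ^ 3 = z ^ 15" by (simp flip: power_add)
        then have "z ^ 3 = 1" unfolding z by simp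
        with z(2) show ?thesis by auto
      qed
      have r0: "r \<noteq> 0" "t \<noteq> 0" using m0 x0 y0 by (auto simp: r_def t_def)
      have "1 / r + 1 / (r * t) = - 1"
        using cube [of r] cube [of t] cube [of "r * t"] r0
        by (intro cube_roots_sum) (simp_all add: power_divide divide_eq_eq eq_divide_eq)
      moreover have "1 / r = - x / m" "1 / (r * t) = - y / m" unfolding rt by (simp_all add: r_def)
      ultimately have "x + y = m" using m0 by (simp add: field_simps)
      then have "{#m#} = part M h c"
        using mc val [OF c] by (intro zero_sum_free_same_sum free [OF c]) auto
      then have "count (part M h c) m = 1" by (metis count_single)
      then show ?thesis using m a by simp
    qed
  qed
qed

lemma repeated_root:
  assumes "sum_of_roots_of_unity h" "minimal_vanishing h" "size h \<le> 21" "count h a \<ge> 2"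
  shows "size h = 21 \<and> count h a = 2"
  using assms
proof (induction "size h" arbitrary: h a rule: less_induct)
  case less
  have roots: "\<forall>z\<in>#h. root_of_unity z" using less.prems by (simp add: sum_of_roots_of_unity_def)
  obtain N b where b: "b \<noteq> 0" and red: "reduced N (image_mset ((*) b) h)"
    using reduced_rotation_exists [OF roots] by blast
  have "size (image_mset ((*) b) h) = 21 \<and> count (image_mset ((*) b) h) (b * a) = 2"
  proof (rule reduced_repeated_root [OF _ red])
    fix g c
    assume g: "size g < size (image_mset ((*) b) h)" "\<forall>z\<in>#g. root_of_unity z" "minimal_vanishing g"
    show "count g c \<le> 1"
    proof (rule ccontr)
      assume c: "\<not> count g c \<le> 1"
      then have "g \<noteq> {#}" by auto
      then have "size g = 21 \<and> count g c = 2"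
        using less.hyps [of g c] less.prems(3) g c by (auto simp: sum_of_roots_of_unity_def)
      then show False using g(1) less.prems(3) by simp
    qed
  qed (use less.prems b in \<open>auto simp: minimal_vanishing_image_mult count_image_mult\<close>)
  then show ?case using b by (simp add: count_image_mult)
qed

section \<open>A sum of weight 21 with a repeated root\<close>

text \<open>
The converse of \<open>equal_subvalues\<close>, as a test for minimality: the parts of a vanishing subsum
are subsums of the parts with one common value.
\<close>

lemma (in prime_split) minimal_vanishingI:
  assumes val: "\<And>c. c \<in> roots_of_one p \<Longrightarrow> sum_mset (part M h c) = v"
    and free: "\<And>c. c \<in> roots_of_one p \<Longrightarrow> zero_sum_free (part M h c)"
    and common: "\<And>u. (\<And>c. c \<in> roots_of_one p \<Longrightarrow> \<exists>g. g \<subseteq># part M h c \<and> sum_mset g = u) \<Longrightarrow> u = 0 \<or> u = v"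
  shows "minimal_vanishing h"
  unfolding minimal_vanishing_def
proof (intro conjI allI impI notI)
  have "sum_mset (assemble p (part M h)) = (\<Sum>c\<in>roots_of_one p. c) * v"
    unfolding sum_mset_assemble sum_distrib_right by (rule sum.cong) (simp_all add: val)
  also have "\<dots> = 0" using sum_roots_unity [of p] prime_gt_1_nat [OF p] by simp
  finally show "vanishing h" by (simp add: assemble_part vanishing_def)
  fix g assume g: "g \<subset># h \<and> g \<noteq> {#}" and van: "vanishing g"
  have gh: "g \<subseteq># h" using g by auto
  interpret g: prime_split p M g
    using p cop M roots mset_subset_eqD [OF gh] by unfold_locales auto
  have sub: "part M g c \<subseteq># part M h c" for c
    unfolding part_def by (intro multiset_filter_mono image_mset_subseteq_mono gh)
  have one: "1 \<in> roots_of_one p" by simp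
  define u where "u = sum_mset (part M g 1)"
  have u: "sum_mset (part M g c) = u" if "c \<in> roots_of_one p" for c
    unfolding u_def using g.part_value_const [OF van that one] .
  then have "u = 0 \<or> u = v" using sub by (intro common) blast
  then show False
  proof
    assume "u = 0"
    then have "part M g c = {#}" if "c \<in> roots_of_one p" for c
      using free [OF that] u [OF that] sub by (auto simp: zero_sum_free_def vanishing_def)
    then have "size g = 0" by (subst g.size_parts) simp
    with g show False by simp
  next
    assume "u = v"
    then have "part M g c = part M h c" if "c \<in> roots_of_one p" for c
      using u [OF that] val [OF that] by (intro zero_sum_free_same_sum free that sub) simp
    then have "size g = size h" by (simp add: g.size_parts size_parts)
    with g show False by (metis less_irrefl mset_subset_size)
  qed
qed

text \<open>
The parts of a vanishing subsum all have the same value, and an empty part forces this to be 0.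
\<close>

lemma (in prime_split) zero_sum_freeI:
  assumes free: "\<And>c. c \<in> roots_of_one p \<Longrightarrow> zero_sum_free (part M h c)"
    and d: "d \<in> roots_of_one p" "part M h d = {#}"
  shows "zero_sum_free h"
  unfolding zero_sum_free_def
proof (intro allI impI)
  fix g assume g: "g \<subseteq># h \<and> vanishing g"
  then have gh: "g \<subseteq># h" by simp
  interpret g: prime_split p M g
    using p cop M roots mset_subset_eqD [OF gh] by unfold_locales auto
  have sub: "part M g c \<subseteq># part M h c" for c
    unfolding part_def using g by (intro multiset_filter_mono image_mset_subseteq_mono) simp
  have "part M g c = {#}" if c: "c \<in> roots_of_one p" for c
  proof -
    have "sum_mset (part M g c) = sum_mset (part M g d)"
      using g by (intro g.part_value_const c d) simp
    also have "part M g d = {#}" using sub [of d] d(2) by simp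
    finally show ?thesis using free [OF c] sub by (auto simp: zero_sum_free_def vanishing_def)
  qed
  then have "size g = 0" by (subst g.size_parts) simp
  then show "g = {#}" by simp
qed

lemma in_sum_family: "finite A \<Longrightarrow> z \<in># (\<Sum>a\<in>A. f a) \<longleftrightarrow> (\<exists>a\<in>A. z \<in># f a)"
  for f :: "'b \<Rightarrow> 'a multiset"
  by (induction A rule: finite_induct) auto

lemma in_assemble: "0 < p \<Longrightarrow> z \<in># assemble p g \<longleftrightarrow> (\<exists>c\<in>roots_of_one p. \<exists>m\<in>#g c. z = c * m)"
proof -
  assume "0 < p"
  then have "finite (roots_of_one p)" by (simp add: finite_roots_unity)
  then show ?thesis by (auto simp: assemble_def in_sum_family)
qed

lemma prime_split_assemble:
  assumes "prime p" "coprime p M" "M > 0"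
    and g: "\<And>c m. c \<in> roots_of_one p \<Longrightarrow> m \<in># g c \<Longrightarrow> m ^ M = 1"
  shows "prime_split p M (assemble p g)"
proof
  fix z assume "z \<in># assemble p g"
  then obtain c m where "c ^ p = 1" "m ^ M = 1" "z = c * m"
    using g prime_gt_0_nat [OF assms(1)] by (auto simp: in_assemble)
  then show "z ^ (p * M) = 1"
    by (simp add: power_mult_distrib power_mult) (metis mult.commute power_mult power_one)
qed (use assms in auto)

lemma part_assemble:
  assumes "prime p" "coprime p M" "M > 0"
    and g: "\<And>c m. c \<in> roots_of_one p \<Longrightarrow> m \<in># g c \<Longrightarrow> m ^ M = 1"
    and c: "c \<in> roots_of_one p"
  shows "part M (assemble p g) c = g c"
proof (rule multiset_eqI)
  interpret prime_split p M "assemble p g" by (rule prime_split_assemble) (use assms in auto)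
  note c0 = class_nonzero [OF c]
  fix m
  have "count (assemble p g) (c * m) = count (g c) m" if m: "m ^ M = 1"
  proof -
    have "count (assemble p g) (c * m) = (\<Sum>d\<in>roots_of_one p. count (g d) (c * m / d))"
      unfolding assemble_def count_sum
      by (intro sum.cong refl count_image_mult class_nonzero)
    also have "\<dots> = (\<Sum>d\<in>roots_of_one p. if d = c then count (g c) m else 0)"
    proof (intro sum.cong refl)
      fix d assume d: "d \<in> roots_of_one p"
      show "count (g d) (c * m / d) = (if d = c then count (g c) m else 0)"
      proof (cases "c * m / d \<in># g d")
        case True
        then have "(c * m / d) ^ M = 1" using g d by blast
        then have "c ^ M = d ^ M"
          using class_nonzero [OF d] m by (simp add: power_divide power_mult_distrib)
        then have "c = d" using inj_power_classes c d by (auto simp: inj_on_def)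
        then show ?thesis using c0 by simp
      next
        case False
        then show ?thesis using c0 by (auto simp: not_in_iff)
      qed
    qed
    also have "\<dots> = count (g c) m" using c finite_classes by simp
    finally show ?thesis .
  qed
  moreover have "count (g c) m = 0" if "m ^ M \<noteq> 1"
    using that c g by (metis count_eq_zero_iff)
  ultimately show "count (part M (assemble p g) c) m = count (g c) m"
    by (simp add: count_part [OF c0])
qed

lemma nontrivial_root_of_one:
  assumes "p > 1"
  shows "\<exists>c\<in>roots_of_one p. c \<noteq> 1"
proof (rule ccontr)
  assume "\<not> ?thesis"
  then have "roots_of_one p = {1}" by auto
  then show False using card_roots_unity_eq [of p] assms by simp
qed

lemma sum_two_apart:
  assumes "finite A" "x \<in> A" "y \<in> A" "x \<noteq> y"
  shows "sum f A = f x + f y + sum f (A - {x, y})"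
proof -
  have "sum f A = f x + sum f (A - {x})" using assms by (simp add: sum.remove)
  also have "sum f (A - {x}) = f y + sum f (A - {x} - {y})"
    using assms by (intro sum.remove) auto
  also have "A - {x} - {y} = A - {x, y}" by auto
  finally show ?thesis by (simp add: add.assoc)
qed

lemma subseteq_single_cases: "g \<subseteq># {#a#} \<Longrightarrow> g = {#} \<or> g = {#a#}"
  by (metis subseteq_add_mset_cases subset_mset.le_zero_eq)

lemma subseteq_pair_cases: "g \<subseteq># {#a, b#} \<Longrightarrow> g \<in> {{#}, {#a#}, {#b#}, {#a, b#}}"
  by (elim subseteq_add_mset_cases) (auto dest: subseteq_single_cases)

lemma zero_sum_free_empty: "zero_sum_free {#}"
  by (simp add: zero_sum_free_def)

lemma zero_sum_free_single: "zero_sum_free {#a#} \<longleftrightarrow> a \<noteq> 0"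
  by (auto simp: zero_sum_free_def vanishing_def dest: subseteq_single_cases)

lemma zero_sum_free_pair: "a \<noteq> 0 \<Longrightarrow> b \<noteq> 0 \<Longrightarrow> a + b \<noteq> 0 \<Longrightarrow> zero_sum_free {#a, b#}"
  by (auto simp: zero_sum_free_def vanishing_def dest!: subseteq_pair_cases)

text \<open>
In the notation of the introduction, \<omega> = \<eta> - 1, the part F is \<open>f0\<close>, the part F' is
\<open>f1\<close>, and \<open>R\<close> is F' \<union> {\<omega>, \<zeta>}. As R is minimal, no subsum of F' has value
-\<omega> or -\<zeta>; the other proper subvalue of a part {-\<omega>, -\<zeta>} is 0, so the minimality
test applies.
\<close>

lemma repeated_root_of_weight_21:
  "\<exists>h. sum_of_roots_of_unity h \<and> minimal_vanishing h \<and> size h = 21 \<and> count h 1 = 2"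
proof -
  obtain \<zeta> where \<zeta>: "\<zeta> \<in> roots_of_one 5" "\<zeta> \<noteq> 1" using nontrivial_root_of_one [of 5] by auto
  obtain s where s: "s \<in> roots_of_one 7" "s \<noteq> 1" using nontrivial_root_of_one [of 7] by auto
  have fin: "finite (roots_of_one 5)" "finite (roots_of_one 7)"
    and card: "card (roots_of_one 5) = 5" "card (roots_of_one 7) = 7"
    by (simp_all add: finite_roots_unity card_roots_unity_eq)
  have one: "1 \<in> roots_of_one p" for p by simp
  have card5: "card (roots_of_one 5 - {1, \<zeta>}) = 3" and card7: "card (roots_of_one 7 - {1, s}) = 5"
    using \<zeta> s fin card by (simp_all add: card_Diff_subset)
  have c5: "coprime 5 (6 :: nat)" and c7: "coprime 7 (30 :: nat)"
    by (simp_all add: prime_imp_coprime)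
  have eta6: "\<eta> ^ 6 = 1" "(\<eta> - 1) ^ 6 = 1" "(- \<eta>) ^ 6 = 1" "(1 - \<eta>) ^ 6 = 1"
    by (simp_all only: sixth_roots) simp_all
  have \<zeta>6: "\<zeta> ^ 6 = \<zeta>"
  proof -
    have "\<zeta> ^ 6 = \<zeta> ^ 5 * \<zeta>" by (simp flip: power_Suc2)
    then show ?thesis using \<zeta>(1) by simp
  qed
  define G where "G c = (if c = 1 \<or> c = \<zeta> then {#1, \<eta> - 1#} else {#\<eta>#})" for c
  define R where "R = assemble 5 G"
  have G6: "m ^ 6 = 1" if "m \<in># G c" for c m
    using that eta6 by (auto simp: G_def split: if_splits)
  interpret R: prime_split 5 6 R
    unfolding R_def by (rule prime_split_assemble) (use c5 G6 in auto)
  have partR: "part 6 R c = G c" if "c \<in> roots_of_one 5" for c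
    unfolding R_def by (rule part_assemble) (use c5 G6 that in auto)
  have "\<exists>c\<in>roots_of_one 5. c \<noteq> 1 \<and> c \<noteq> \<zeta>"
  proof -
    have "roots_of_one 5 - {1, \<zeta>} \<noteq> {}" using card5 by (metis card.empty zero_neq_numeral)
    then show ?thesis by blast
  qed
  then obtain \<zeta>' where \<zeta>': "\<zeta>' \<in> roots_of_one 5" "\<zeta>' \<noteq> 1" "\<zeta>' \<noteq> \<zeta>" by blast
  have minR: "minimal_vanishing R"
  proof (rule R.minimal_vanishingI [where v = \<eta>])
    fix c assume c: "c \<in> roots_of_one 5"
    show "sum_mset (part 6 R c) = \<eta>" by (simp add: partR [OF c] G_def)
    show "zero_sum_free (part 6 R c)"
      using eta_neq by (simp add: partR [OF c] G_def zero_sum_free_single zero_sum_free_pair)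
  next
    fix u assume "\<And>c. c \<in> roots_of_one 5 \<Longrightarrow> \<exists>g. g \<subseteq># part 6 R c \<and> sum_mset g = u"
    from this [OF \<zeta>'(1)] show "u = 0 \<or> u = \<eta>"
      using \<zeta>' by (auto simp: partR G_def dest: subseteq_single_cases)
  qed
  have sizeR: "size R = 7"
    unfolding R_def size_assemble sum_two_apart [OF fin(1) one \<zeta>(1) \<zeta>(2) [symmetric]]
    using card5 by (simp add: G_def)
  have "1 * (\<eta> - 1) \<in># R" "\<zeta> * 1 \<in># R"
    unfolding R_def in_assemble [OF zero_less_numeral] using \<zeta>(1) by (force simp: G_def)+
  then have "\<eta> - 1 \<in># R" "\<zeta> \<in># R" by simp_all
  moreover have "\<zeta> \<noteq> \<eta> - 1" using \<zeta>6 \<zeta>(2) eta6(2) by metis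
  ultimately have subR: "{#\<eta> - 1, \<zeta>#} \<subseteq># R"
    by (auto simp: insert_subset_eq_iff in_diff_count)
  define f1 where "f1 = R - {#\<eta> - 1, \<zeta>#}"
  have Rf1: "R = add_mset (\<eta> - 1) (add_mset \<zeta> f1)"
    using subset_mset.add_diff_inverse [OF subR] by (simp add: f1_def)
  have size1: "size f1 = 5" using sizeR Rf1 by simp
  define G0 where "G0 c = (if c = 1 then {#1, 1, - \<eta>#} else if c = \<zeta> then {#} else {#1#})" for c
  define f0 where "f0 = assemble 5 G0"
  have G06: "m ^ 6 = 1" if "m \<in># G0 c" for c m
    using that eta6 by (auto simp: G0_def split: if_splits)
  interpret f0: prime_split 5 6 f0
    unfolding f0_def by (rule prime_split_assemble) (use c5 G06 in auto)
  have part0: "part 6 f0 c = G0 c" if "c \<in> roots_of_one 5" for c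
    unfolding f0_def by (rule part_assemble) (use c5 G06 that in auto)
  have free3: "zero_sum_free {#1, 1, - \<eta>#}"
    unfolding zero_sum_free_def vanishing_def
  proof (intro allI impI, elim conjE)
    fix g assume g: "g \<subseteq># {#1, 1, - \<eta>#}" and zero: "sum_mset g = 0"
    have nz: "sum_mset {#1#} \<noteq> (0 :: complex)" "sum_mset {#- \<eta>#} \<noteq> 0" "sum_mset {#1, - \<eta>#} \<noteq> 0"
      "sum_mset {#1, 1#} \<noteq> (0 :: complex)" "sum_mset {#1, 1, - \<eta>#} \<noteq> 0"
      by (simp_all add: \<eta>_def complex_eq_iff)
    have "g \<in> {{#}, {#1#}, {#- \<eta>#}, {#1, - \<eta>#}, {#1, 1#}, {#1, 1, - \<eta>#}}"
      using g
    proof (cases rule: subseteq_add_mset_cases)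
      case 1
      then show ?thesis using subseteq_pair_cases [of g 1 "- \<eta>"] by auto
    next
      case (2 g')
      then show ?thesis using subseteq_pair_cases [of g' 1 "- \<eta>"] by auto
    qed
    then show "g = {#}" using zero nz by (elim insertE emptyE) (simp_all only: simp_thms)
  qed
  have free0: "zero_sum_free f0"
  proof (rule f0.zero_sum_freeI)
    show "zero_sum_free (part 6 f0 c)" if "c \<in> roots_of_one 5" for c
      using free3 unfolding part0 [OF that] G0_def
      by (simp add: zero_sum_free_single zero_sum_free_empty)
    show "part 6 f0 \<zeta> = {#}" using \<zeta> by (simp add: part0 G0_def)
  qed (rule \<zeta>(1))
  have size0: "size f0 = 6"
    unfolding f0_def size_assemble sum_two_apart [OF fin(1) one \<zeta>(1) \<zeta>(2) [symmetric]]
    using card5 \<zeta> by (simp add: G0_def)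
  have count0: "count f0 1 = 2"
    using count_part [of 1 6 f0 1] eta_neq by (simp add: part0 G0_def)
  have val0: "sum_mset f0 = 1 - \<eta> - \<zeta>"
  proof -
    have "sum_mset f0 = 2 - \<eta> + (\<Sum>c\<in>roots_of_one 5 - {1, \<zeta>}. c * sum_mset (G0 c))"
      unfolding f0_def sum_mset_assemble sum_two_apart [OF fin(1) one \<zeta>(1) \<zeta>(2) [symmetric]]
      using \<zeta> by (simp add: G0_def)
    also have "(\<Sum>c\<in>roots_of_one 5 - {1, \<zeta>}. c * sum_mset (G0 c)) = (\<Sum>c\<in>roots_of_one 5 - {1, \<zeta>}. c)"
      by (rule sum.cong) (auto simp: G0_def)
    also have "\<dots> = - 1 - \<zeta>"
      using sum_two_apart [OF fin(1) one \<zeta>(1) \<zeta>(2) [symmetric], of "\<lambda>c. c"] sum_roots_unity [of 5]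
      by (simp add: algebra_simps eq_neg_iff_add_eq_0)
    finally show ?thesis by simp
  qed
  define F where "F c = (if c = 1 then f0 else if c = s then f1 else {#1 - \<eta>, - \<zeta>#})" for c
  define h where "h = assemble 7 F"
  have \<zeta>30: "\<zeta> ^ 30 = 1" using root_of_unity_power_dvd [of \<zeta> 5 30] \<zeta> by simp
  have F30: "m ^ 30 = 1" if m: "m \<in># F c" for c m
  proof -
    have "m \<in># f0 \<or> m \<in># f1 \<or> m = 1 - \<eta> \<or> m = - \<zeta>"
      using m by (auto simp: F_def split: if_splits)
    moreover have "m ^ 30 = 1" if "m \<in># f0" using f0.roots [OF that] by simp
    moreover have "m ^ 30 = 1" if "m \<in># f1"
    proof -
      have "m \<in># R" using that by (simp add: Rf1)
      then show ?thesis using R.roots [of m] by simp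
    qed
    moreover have "(1 - \<eta>) ^ 30 = 1" by (rule root_of_unity_power_dvd [OF eta6(4)]) simp
    moreover have "(- \<zeta>) ^ 30 = 1" using \<zeta>30 by simp
    ultimately show ?thesis by blast
  qed
  interpret prime_split 7 30 h
    unfolding h_def by (rule prime_split_assemble) (use c7 F30 in auto)
  have part: "part 30 h c = F c" if "c \<in> roots_of_one 7" for c
    unfolding h_def by (rule part_assemble) (use c7 F30 that in auto)
  have "\<exists>c\<in>roots_of_one 7. c \<noteq> 1 \<and> c \<noteq> s"
  proof -
    have "roots_of_one 7 - {1, s} \<noteq> {}" using card7 by (metis card.empty zero_neq_numeral)
    then show ?thesis by blast
  qed
  then obtain s' where s': "s' \<in> roots_of_one 7" "s' \<noteq> 1" "s' \<noteq> s" by blast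
  have "sum_mset R = 0" using minR by (simp add: minimal_vanishing_def vanishing_def)
  then have val1: "sum_mset f1 = 1 - \<eta> - \<zeta>" by (simp add: Rf1 algebra_simps eq_neg_iff_add_eq_0)
  have R_only: "g = {#} \<or> g = R" if "g \<subseteq># R" "sum_mset g = 0" for g
    using minimal_vanishing_sub [OF minR] that by (auto simp: vanishing_def)
  have free1: "zero_sum_free f1"
    unfolding zero_sum_free_def vanishing_def
  proof (intro allI impI, elim conjE)
    fix g assume g: "g \<subseteq># f1" "sum_mset g = 0"
    have "g \<subseteq># R"
      by (rule subset_mset.order_trans [OF g(1)]) (simp add: f1_def)
    moreover have "size g \<noteq> size R" using size_mset_mono [OF g(1)] size1 sizeR by simp
    ultimately show "g = {#}" using R_only g(2) by blast
  qed
  have minh: "minimal_vanishing h"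
  proof (rule minimal_vanishingI [where v = "1 - \<eta> - \<zeta>"])
    fix c assume c: "c \<in> roots_of_one 7"
    show "sum_mset (part 30 h c) = 1 - \<eta> - \<zeta>"
      using val0 val1 by (simp add: part [OF c] F_def)
    have "\<zeta> \<noteq> 1 - \<eta>" using \<zeta>6 \<zeta>(2) eta6(4) by metis
    then have "zero_sum_free {#1 - \<eta>, - \<zeta>#}"
      using eta_neq \<zeta> by (intro zero_sum_free_pair) auto
    then show "zero_sum_free (part 30 h c)"
      using free0 free1 by (simp add: part [OF c] F_def)
  next
    fix u assume u: "\<And>c. c \<in> roots_of_one 7 \<Longrightarrow> \<exists>g. g \<subseteq># part 30 h c \<and> sum_mset g = u"
    obtain g where g: "g \<subseteq># f1" "sum_mset g = u"
      using u [OF s(1)] s by (auto simp: part F_def)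
    have avoid: "u \<noteq> - x" if "x = \<eta> - 1 \<or> x = \<zeta>" for x
    proof
      assume "u = - x"
      then have "sum_mset (add_mset x g) = 0" using g by simp
      moreover have "add_mset x g \<subseteq># R"
      proof -
        have g_sub: "g \<subseteq># add_mset y f1" for y
          by (rule subset_mset.order_trans [OF g(1)]) simp
        from that show ?thesis
        proof
          assume x: "x = \<eta> - 1"
          show ?thesis unfolding x Rf1 mset_subset_eq_add_mset_cancel by (rule g_sub)
        next
          assume x: "x = \<zeta>"
          show ?thesis
            unfolding x Rf1 add_mset_commute [of "\<eta> - 1"] mset_subset_eq_add_mset_cancel by (rule g_sub)
        qed
      qed
      ultimately have "add_mset x g = {#} \<or> add_mset x g = R" by (intro R_only)
      then have "add_mset x g = R" by (rule disjE) simp_all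
      then have "Suc (size g) = 7" using sizeR by (metis size_add_mset)
      then show False using size_mset_mono [OF g(1)] size1 by simp
    qed
    have "u \<noteq> - (\<eta> - 1)" "u \<noteq> - \<zeta>" by (rule avoid, simp)+
    then have avoids: "u \<noteq> 1 - \<eta>" "u \<noteq> - \<zeta>" by simp_all
    obtain k where k: "k \<subseteq># {#1 - \<eta>, - \<zeta>#}" "sum_mset k = u"
      using u [OF s'(1)] s'(2,3) unfolding part [OF s'(1)] F_def by auto
    from subseteq_pair_cases [OF k(1)] have "u \<in> {0, 1 - \<eta>, - \<zeta>, 1 - \<eta> - \<zeta>}"
      unfolding k(2) [symmetric] by (elim insertE emptyE) simp_all
    with avoids show "u = 0 \<or> u = 1 - \<eta> - \<zeta>" by blast
  qed
  have size_h: "size h = 21"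
    unfolding h_def size_assemble sum_two_apart [OF fin(2) one s(1) s(2) [symmetric]]
    using card7 s size0 size1 by (simp add: F_def)
  moreover have "count h 1 = 2"
    using count_part [of 1 30 h 1] count0 by (simp add: part F_def)
  moreover have "sum_of_roots_of_unity h"
    unfolding sum_of_roots_of_unity_def
  proof (intro conjI ballI)
    show "h \<noteq> {#}" using size_h by auto
    show "root_of_unity z" if "z \<in># h" for z
      unfolding root_of_unity_def by (rule exI [of _ "7 * 30"]) (use roots [OF that] in simp)
  qed
  ultimately show ?thesis using minh by blast
qed

lemma height_attained:
  assumes "h \<noteq> {#}"
  shows "\<exists>a\<in>#h. count h a = height h"
proof -
  have "Max (count h ` set_mset h) \<in> count h ` set_mset h"
    by (rule Max_in) (use assms in auto)
  then show ?thesis by (auto simp: height_def)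
qed

theorem theorem4p3:
  shows "(\<forall>h. sum_of_roots_of_unity h \<and> minimal_vanishing h \<and> weight h < 21 \<longrightarrow> height h = 1) \<and>
         (\<exists>h. sum_of_roots_of_unity h \<and> minimal_vanishing h \<and> weight h = 21 \<and> height h > 1) \<and>
         (\<forall>h. sum_of_roots_of_unity h \<and> minimal_vanishing h \<and> weight h = 21 \<and> height h > 1 \<longrightarrow>
              height h = 2)"
proof (intro conjI allI impI; (elim conjE)?)
  fix h assume h: "sum_of_roots_of_unity h" "minimal_vanishing h" "weight h < 21"
  then obtain a where a: "a \<in># h" "count h a = height h"
    using height_attained by (auto simp: sum_of_roots_of_unity_def)
  have "\<not> count h a \<ge> 2" using repeated_root [of h a] h by auto
  moreover have "count h a \<ge> 1" using a(1) by (simp add: Suc_le_eq)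
  ultimately show "height h = 1" using a(2) by simp
next
  obtain h where h: "sum_of_roots_of_unity h" "minimal_vanishing h" "size h = 21" "count h 1 = 2"
    using repeated_root_of_weight_21 by blast
  have "1 \<in># h" using h(4) by (metis count_eq_zero_iff zero_neq_numeral)
  then have "count h 1 \<le> height h" unfolding height_def by (intro Max_ge) auto
  with h show "\<exists>h. sum_of_roots_of_unity h \<and> minimal_vanishing h \<and> weight h = 21 \<and> height h > 1"
    by (intro exI [of _ h]) auto
next
  fix h assume h: "sum_of_roots_of_unity h" "minimal_vanishing h" "weight h = 21" "height h > 1"
  then obtain a where a: "a \<in># h" "count h a = height h"
    using height_attained by (auto simp: sum_of_roots_of_unity_def)
  then show "height h = 2" using repeated_root [of h a] h by simp
qed

end
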